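(* Let $G$ be an infinite, connected, quasi-transitive, cubic graph, let $\phi$ be a local transformation, and let $G_1=\phi(G)$ (assumed connected). Let $\mu=\mu(G)$ and $\mu_1=\mu(G_1)$ be the connective constants of $G$ and $G_1$. Then \[ \mu^{-1}=g_\phi\bigl(\mu_1^{-1}\bigr), \] where $g_\phi$ is the gadget series of $\phi$. Equivalently, $\mu_1^{-1}$ is the unique positive solution $x$ of $g_\phi(x)=\mu^{-1}$.
   Context: All graphs are simple (no loops, no multiple edges). A graph $G=(V,E)$ is quasi-transitive if there is a finite $W\subseteq V$ such that every vertex is mapped into $W$ by some automorphism of $G$ (such $W$ is a fundamental domain); it is cubic if every vertex has degree $3$. Local transformation: a local transformation $\phi$ acts at a degree-$3$ vertex $v$ of a simple graph by replacing $v$ with a finite connected graph (the gadget) $\phi(v)$ having three distinct distinguished outer vertices (ports) $w_1,w_2,w_3$, each port being attached to exactly one of the three edges formerly incident to $v$ (one port per edge). It is required that (i) all gadgets $\phi(v)$ are isomorphic via isomorphisms sending ports to ports, and (ii) some subgroup of the automorphism group of $\phi(v)$ preserves the set $\{w_1,w_2,w_3\}$ and acts transitively on it. $\phi(G)$ denotes the graph obtained by applying $\phi$ at every degree-$3$ vertex of $G$. Mid-edge convention: each edge $e$ is identified with a point at its middle (also denoted $e$). Walks may start and end at mid-edges; such a walk is self-avoiding (a SAW) if it visits no vertex and no mid-edge more than once, and its length $|\pi|$ is the number of vertices it visits. Gadget series: for a degree-$3$ vertex $v$ with incident edges $e_1,e_2,e_3$, $g(x)=g_\phi(x)=\sum_{\pi}x^{|\pi|}$,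 where the sum is over all SAWs $\pi$ that start at the mid-edge of $e_1$, end at the mid-edge of $e_2$, and otherwise visit only vertices of the gadget $\phi(v)$. This polynomial does not depend on $v$ nor on the chosen pair of incident edges. Connective constant: for quasi-transitive $G$, $\mu(G)=\lim_{n\to\infty}\sigma_n(v)^{1/n}$, where $\sigma_n(v)$ is the number of $n$-step SAWs (in the usual vertex sense) starting at the vertex $v$; this limit exists and does not depend on $v$. *)

theory Defs
  imports Complex_Main "HOL-Library.FuncSet"
begin

definition simple_graph :: "'a set \<Rightarrow> ('a \<Rightarrow> 'a \<Rightarrow> bool) \<Rightarrow> bool" where
  "simple_graph V E \<longleftrightarrow> (\<forall>u v. E u v \<longrightarrow> u \<in> V \<and> v \<in> V \<and> u \<noteq> v \<and> E v u)"

definition graph_connected :: "'a set \<Rightarrow> ('a \<Rightarrow> 'a \<Rightarrow> bool) \<Rightarrow> bool" where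
  "graph_connected V E \<longleftrightarrow> (\<forall>u\<in>V. \<forall>v\<in>V. E\<^sup>*\<^sup>* u v)"

definition cubic :: "'a set \<Rightarrow> ('a \<Rightarrow> 'a \<Rightarrow> bool) \<Rightarrow> bool" where
  "cubic V E \<longleftrightarrow> (\<forall>v\<in>V. card {u. E v u} = 3)"

definition is_aut :: "'a set \<Rightarrow> ('a \<Rightarrow> 'a \<Rightarrow> bool) \<Rightarrow> ('a \<Rightarrow> 'a) \<Rightarrow> bool" where
  "is_aut V E f \<longleftrightarrow> bij_betw f V V \<and> (\<forall>u\<in>V. \<forall>v\<in>V. E u v \<longleftrightarrow> E (f u) (f v))"

definition quasi_transitive :: "'a set \<Rightarrow> ('a \<Rightarrow> 'a \<Rightarrow> bool) \<Rightarrow> bool" where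
  "quasi_transitive V E \<longleftrightarrow>
     (\<exists>W. finite W \<and> W \<subseteq> V \<and> (\<forall>v\<in>V. \<exists>f. is_aut V E f \<and> f v \<in> W))"

definition saws :: "('a \<Rightarrow> 'a \<Rightarrow> bool) \<Rightarrow> 'a \<Rightarrow> nat \<Rightarrow> 'a list set" where
  "saws E v n = {p. length p = Suc n \<and> hd p = v \<and> distinct p \<and>
                    (\<forall>i<n. E (p ! i) (p ! Suc i))}"

definition connective_constant :: "'a set \<Rightarrow> ('a \<Rightarrow> 'a \<Rightarrow> bool) \<Rightarrow> real" where
  "connective_constant V E =
     lim (\<lambda>n. root n (real (card (saws E (SOME v. v \<in> V) n))))"

definition is_gadget :: "'b set \<Rightarrow> ('b \<Rightarrow> 'b \<Rightarrow> bool) \<Rightarrow> 'b \<Rightarrow> 'b \<Rightarrow> 'b \<Rightarrow> bool" where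
  "is_gadget \<Gamma> Eg w1 w2 w3 \<longleftrightarrow>
     finite \<Gamma> \<and> simple_graph \<Gamma> Eg \<and> graph_connected \<Gamma> Eg \<and>
     w1 \<in> \<Gamma> \<and> w2 \<in> \<Gamma> \<and> w3 \<in> \<Gamma> \<and> w1 \<noteq> w2 \<and> w1 \<noteq> w3 \<and> w2 \<noteq> w3 \<and>
     (\<exists>H. H \<subseteq> {f. is_aut \<Gamma> Eg f \<and> f \<in> extensional \<Gamma>} \<and>
          restrict id \<Gamma> \<in> H \<and>
          (\<forall>f\<in>H. \<forall>g\<in>H. compose \<Gamma> f g \<in> H) \<and>
          (\<forall>f\<in>H. restrict (inv_into \<Gamma> f) \<Gamma> \<in> H) \<and>
          (\<forall>f\<in>H. f ` {w1, w2, w3} = {w1, w2, w3}) \<and>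
          (\<forall>a\<in>{w1, w2, w3}. \<forall>b\<in>{w1, w2, w3}. \<exists>f\<in>H. f a = b))"

definition is_local_transformation ::
  "'a set \<Rightarrow> ('a \<Rightarrow> 'a \<Rightarrow> bool) \<Rightarrow> 'b set \<Rightarrow> ('b \<Rightarrow> 'b \<Rightarrow> bool) \<Rightarrow> 'b \<Rightarrow> 'b \<Rightarrow> 'b
     \<Rightarrow> ('a \<Rightarrow> 'a \<Rightarrow> 'b) \<Rightarrow> bool" where
  "is_local_transformation V E \<Gamma> Eg w1 w2 w3 port \<longleftrightarrow>
     is_gadget \<Gamma> Eg w1 w2 w3 \<and> (\<forall>v\<in>V. bij_betw (port v) {u. E v u} {w1, w2, w3})"

definition tf_edges ::
  "'a set \<Rightarrow> ('a \<Rightarrow> 'a \<Rightarrow> bool) \<Rightarrow> 'b set \<Rightarrow> ('b \<Rightarrow> 'b \<Rightarrow> bool) \<Rightarrow> ('a \<Rightarrow> 'a \<Rightarrow> 'b)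
     \<Rightarrow> ('a \<times> 'b) \<Rightarrow> ('a \<times> 'b) \<Rightarrow> bool" where
  "tf_edges V E \<Gamma> Eg port x y \<longleftrightarrow>
     (case x of (u, a) \<Rightarrow> case y of (v, b) \<Rightarrow>
        u \<in> V \<and> v \<in> V \<and> a \<in> \<Gamma> \<and> b \<in> \<Gamma> \<and>
        ((u = v \<and> Eg a b) \<or> (E u v \<and> a = port u v \<and> b = port v u)))"

text \<open>Self-avoiding paths inside the gadget from port a to port b (= SAWs from a mid-edge at a
  to a mid-edge at b visiting only gadget vertices); length = number of vertices.\<close>
definition gadget_paths :: "('b \<Rightarrow> 'b \<Rightarrow> bool) \<Rightarrow> 'b \<Rightarrow> 'b \<Rightarrow> 'b list set" where
  "gadget_paths Eg a b = {p. p \<noteq> [] \<and> hd p = a \<and> last p = b \<and> distinct p \<and>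
                             (\<forall>i. Suc i < length p \<longrightarrow> Eg (p ! i) (p ! Suc i))}"

definition gadget_series :: "('b \<Rightarrow> 'b \<Rightarrow> bool) \<Rightarrow> 'b \<Rightarrow> 'b \<Rightarrow> real \<Rightarrow> real" where
  "gadget_series Eg a b x = (\<Sum>p\<in>gadget_paths Eg a b. x ^ length p)"

end

theory Submission
  imports Defs
begin

text \<open>
  Contracting the gadgets maps a self-avoiding walk of the transformed graph to a walk of the
  original graph. A passage through a gadget uses two of its three ports, so this projection is
  self-avoiding except possibly at its two end vertices, and the generating function of the walks
  over a self-avoiding walk with \<open>k\<close> interior vertices is \<open>g x ^ k\<close> up to bounded factors.
  Hence the generating function of the transformed graph at \<open>x\<close> behaves like that of the
  original one at \<open>g x\<close>, and the critical points correspond.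

  The transformed graph need not be quasi-transitive, as the ports may be attached with arbitrary
  orientations, so the limit defining its connective constant is not available beforehand.
  For both graphs it comes from the same principle: a uniform upper bound at every rate above the
  critical one, and a lower bound at every rate below it for one length in each window
  \<open>[m, K m + K]\<close>.
\<close>

section \<open>Growth rates\<close>

text \<open>The two bounds are asymmetric. An upper bound has to be uniform in the start vertex,
  because the remainder of a cut walk may start anywhere; a lower bound is wanted at one fixed
  vertex. Lower bounds are sparse for two different reasons. In the quasi-transitive graph the
  vertex of the fundamental domain with the most walks depends on the length, and rerouting its
  walks to a fixed vertex breaks them into two arms whose lengths are not controlled. In the
  transformed graph a gadget is crossed in no fixed number of steps, so the walks over walks of one
  length are spread over a window of lengths. In both cases averaging singles out one length at the
  price of a factor linear in \<open>m\<close>, which an arbitrarily small change of the rate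
  absorbs. The limit is never obtained by an existence argument for the transformed graph: a root of
  the gadget series is produced beforehand, and every rate on either side of its inverse is then
  tested.\<close>

lemma tendsto_root_if_geometric_bounds:
  fixes f :: "nat \<Rightarrow> real"
  assumes l: "0 < l"
    and upper: "\<And>r. l < r \<Longrightarrow> \<exists>C. \<forall>\<^sub>F n in sequentially. f n \<le> C * r ^ n"
    and lower: "\<And>r. 0 < r \<Longrightarrow> r < l \<Longrightarrow> \<exists>c>0. \<forall>\<^sub>F n in sequentially. c * r ^ n \<le> f n"
  shows "(\<lambda>n. root n (f n)) \<longlonglongrightarrow> l"
proof (rule order_tendstoI)
  fix a assume a: "a < l"
  define r where "r = (max a 0 + l) / 2"
  have r: "0 < r" "r < l" "a < r" using a l by (auto simp: r_def)
  obtain c where c: "c > 0" "\<forall>\<^sub>F n in sequentially. c * r ^ n \<le> f n"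
    using lower[OF r(1,2)] by blast
  have "(\<lambda>n. root n c * r) \<longlonglongrightarrow> 1 * r"
    by (intro tendsto_intros LIMSEQ_root_const c(1))
  then have "\<forall>\<^sub>F n in sequentially. a < root n c * r"
    using r(3) by (auto dest: order_tendstoD(1))
  then show "\<forall>\<^sub>F n in sequentially. a < root n (f n)"
    using c(2) eventually_gt_at_top[of 0]
  proof eventually_elim
    case (elim n)
    have "root n c * r = root n (c * r ^ n)"
      using elim r by (simp add: real_root_mult real_root_power_cancel)
    also have "\<dots> \<le> root n (f n)" using elim by simp
    finally show ?case using elim by simp
  qed
next
  fix a assume a: "l < a"
  define r where "r = (a + l) / 2"
  have r: "0 < r" "l < r" "r < a" using a l by (auto simp: r_def)
  obtain C where C: "\<forall>\<^sub>F n in sequentially. f n \<le> C * r ^ n"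
    using upper[OF r(2)] by blast
  \<comment> \<open>\<open>C\<close> may be nonpositive, and \<open>root n D\<close> tends to 1 only
    for a positive constant.\<close>
  define D where "D = max C 1"
  have "(\<lambda>n. root n D * r) \<longlonglongrightarrow> 1 * r"
    by (intro tendsto_intros LIMSEQ_root_const) (simp add: D_def)
  then have "\<forall>\<^sub>F n in sequentially. root n D * r < a"
    using r(3) by (auto dest: order_tendstoD(2))
  then show "\<forall>\<^sub>F n in sequentially. root n (f n) < a"
    using C eventually_gt_at_top[of 0]
  proof eventually_elim
    case (elim n)
    have "f n \<le> D * r ^ n"
      using elim r by (smt (verit) D_def mult_right_mono zero_le_power)
    then have "root n (f n) \<le> root n (D * r ^ n)" using elim by simp
    also have "\<dots> = root n D * r"
      using elim r by (simp add: real_root_mult real_root_power_cancel)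
    finally show ?case using elim by simp
  qed
qed

text \<open>A lower bound at one index \<open>n\<close> of each window \<open>[m, K m + K]\<close> is pulled back to \<open>m\<close>
  itself, since \<open>f\<close> grows at most at rate about \<open>l\<close> between \<open>m\<close> and \<open>n\<close>.\<close>

lemma tendsto_root_if_sparse_lower_bound:
  fixes f :: "nat \<Rightarrow> real"
  assumes l: "0 < l"
    and f0: "\<And>n. 0 \<le> f n"
    and upper: "\<And>r. l < r \<Longrightarrow> \<exists>C. \<forall>m n. f (m + n) \<le> f m * (C * r ^ n)"
    and lower: "\<And>r. 0 < r \<Longrightarrow> r < l \<Longrightarrow>
      \<exists>c>0. \<forall>\<^sub>F m in sequentially. \<exists>n. m \<le> n \<and> n \<le> K * m + K \<and> c * r ^ n \<le> f n"
  shows "(\<lambda>n. root n (f n)) \<longlonglongrightarrow> l"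
proof (rule tendsto_root_if_geometric_bounds[OF l])
  fix r assume "l < r"
  from upper[OF this] obtain C where "\<forall>m n. f (m + n) \<le> f m * (C * r ^ n)" by blast
  from spec[OF this, of 0] show "\<exists>C. \<forall>\<^sub>F n in sequentially. f n \<le> C * r ^ n"
    by (intro exI[of _ "f 0 * C"]) (simp add: mult.assoc)
next
  fix r assume r: "0 < r" "r < l"
  \<comment> \<open>Working at the rates \<open>l / t\<close> and \<open>l * t\<close> loses
    \<open>t\<close> per step up to \<open>m\<close>, and their quotient \<open>t\<close> squared
    per step on the at most \<open>K * m + K\<close> steps from \<open>m\<close> to
    \<open>n\<close>. The total is \<open>t ^ (2 * K + 1)\<close> per unit of \<open>m\<close>,
    which is to equal \<open>l / r\<close>.\<close>
  define t where "t = root (2 * K + 1) (l / r)"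
  have t: "t > 1" "t ^ (2 * K + 1) = l / r"
    unfolding t_def using r by (simp, intro real_root_pow_pos2) auto
  have "l / t < l" "l < l * t" "0 < l / t" using t l by (simp_all add: field_simps)
  from lower[OF this(3,1)] upper[OF this(2)] obtain c C where c: "c > 0"
    and lo: "\<forall>\<^sub>F m in sequentially. \<exists>n. m \<le> n \<and> n \<le> K * m + K \<and> c * (l / t) ^ n \<le> f n"
    and up: "\<And>m n. f (m + n) \<le> f m * (C * (l * t) ^ n)" by blast
  define D where "D = max C 1"
  have D: "D > 0" by (simp add: D_def)
  have up': "f (m + n) \<le> f m * (D * (l * t) ^ n)" for m n
  proof -
    have "f (m + n) \<le> f m * (C * (l * t) ^ n)" by (rule up)
    also have "\<dots> \<le> f m * (D * (l * t) ^ n)"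
      using l t f0 by (intro mult_left_mono mult_right_mono) (auto simp: D_def)
    finally show ?thesis .
  qed
  define c' where "c' = c / D / t ^ (2 * K)"
  have "\<forall>\<^sub>F m in sequentially. c' * r ^ m \<le> f m"
    using lo
  proof eventually_elim
    case (elim m)
    then obtain n where n: "m \<le> n" "n \<le> K * m + K" "c * (l / t) ^ n \<le> f n" by blast
    obtain d where d: "n = m + d" using n(1) le_iff_add by blast
    have "c * (l / t) ^ n \<le> f m * (D * (l * t) ^ d)"
      using n(3) up'[of m d] d by simp
    then have "c * ((l / t) ^ m * (l / t) ^ d) / (D * (l * t) ^ d) \<le> f m"
      using D l t by (simp add: d power_add pos_divide_le_eq)
    moreover have "c * ((l / t) ^ m * (l / t) ^ d) / (D * (l * t) ^ d)
        = c / D * (l / t) ^ m * (1 / t ^ (2 * d))"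
      using D l t by (simp add: field_simps power_mult_distrib power_mult power2_eq_square)
    moreover have "c / D * (l / t) ^ m * (1 / t ^ (2 * d))
        \<ge> c / D * (l / t) ^ m * (1 / t ^ (2 * (K * m + K)))"
      using c D l t n(2) d by (intro mult_left_mono divide_left_mono power_increasing) auto
    moreover have "c / D * (l / t) ^ m * (1 / t ^ (2 * (K * m + K))) = c' * r ^ m"
    proof -
      have "r = l / t ^ (2 * K + 1)" unfolding t(2) using r by simp
      then have "r ^ m = (l / t) ^ m / t ^ (2 * K * m)"
        by (simp add: power_divide power_mult power_mult_distrib)
      then show ?thesis
        by (simp add: c'_def power_add distrib_left mult.assoc)
    qed
    ultimately show ?case by linarith
  qed
  moreover have "c' > 0" using c D t by (simp add: c'_def)
  ultimately show "\<exists>c>0. \<forall>\<^sub>F n in sequentially. c * r ^ n \<le> f n" by blast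
qed

lemma saws_eq:
  "saws E v n = {p. length p = Suc n \<and> hd p = v \<and> distinct p \<and> successively E p}"
  by (auto simp: saws_def successively_conv_nth)

lemma gadget_paths_eq:
  "gadget_paths Eg a b = {p. p \<noteq> [] \<and> hd p = a \<and> last p = b \<and> distinct p \<and> successively Eg p}"
  by (auto simp: gadget_paths_def successively_conv_nth)

section \<open>Self-avoiding walks\<close>

lemma last_take_Suc: "i < length p \<Longrightarrow> last (take (Suc i) p) = p ! i"
  by (simp add: take_Suc_conv_app_nth)

lemma set_saw_subset:
  assumes "simple_graph V E" "v \<in> V" "p \<in> saws E v n"
  shows "set p \<subseteq> V"
proof -
  have "successively E p \<Longrightarrow> p \<noteq> [] \<Longrightarrow> hd p \<in> V \<Longrightarrow> set p \<subseteq> V" for p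
    using assms(1) by (induction p rule: induct_list012) (auto simp: simple_graph_def)
  moreover have "p \<noteq> []" using assms(3) by (auto simp: saws_eq)
  ultimately show ?thesis using assms(2,3) by (simp add: saws_eq)
qed

lemma finite_saws:
  assumes "\<And>v. finite {u. E v u}"
  shows "finite (saws E v n)"
proof (induction n)
  case 0
  have "saws E v 0 \<subseteq> {[v]}" by (auto simp: saws_eq length_Suc_conv)
  then show ?case by (rule finite_subset) simp
next
  case (Suc n)
  have "saws E v (Suc n) \<subseteq> (\<Union>p\<in>saws E v n. (\<lambda>u. p @ [u]) ` {u. E (last p) u})"
  proof
    fix p assume p: "p \<in> saws E v (Suc n)"
    then obtain q u where q: "p = q @ [u]" by (cases p rule: rev_cases) (auto simp: saws_eq)
    with p have "q \<noteq> []" by (auto simp: saws_eq)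
    with p q show "p \<in> (\<Union>p\<in>saws E v n. (\<lambda>u. p @ [u]) ` {u. E (last p) u})"
      by (auto simp: saws_eq successively_append_iff)
  qed
  then show ?case by (rule finite_subset) (use Suc assms in auto)
qed

text \<open>A walk is cut at its vertex number \<open>m\<close>, which ends the first piece and
  starts the second; hence the \<open>tl\<close> when the pieces are glued. The second piece can
  start anywhere, so \<open>B\<close> has to serve all vertices.\<close>

lemma card_saws_add_le:
  assumes "simple_graph V E" and fin: "\<And>v. finite {u. E v u}" and v: "v \<in> V"
    and B: "\<And>u. u \<in> V \<Longrightarrow> real (card (saws E u n)) \<le> B"
  shows "real (card (saws E v (m + n))) \<le> real (card (saws E v m)) * B"
proof -
  let ?S = "SIGMA q:saws E v m. saws E (last q) n"
  have "saws E v (m + n) \<subseteq> (\<lambda>(q, r). q @ tl r) ` ?S"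
  proof
    fix p assume p: "p \<in> saws E v (m + n)"
    let ?q = "take (Suc m) p" and ?r = "drop m p"
    have l: "length p = Suc (m + n)" using p by (simp add: saws_eq)
    have suc: "successively E p" using p by (simp add: saws_eq)
    have "successively E ?q" "successively E ?r"
      using suc l by (auto simp: successively_conv_nth)
    then have "?q \<in> saws E v m" "?r \<in> saws E (last ?q) n"
      using p l by (auto simp: saws_eq hd_drop_conv_nth last_take_Suc)
    moreover have "p = ?q @ tl ?r"
      by (metis append_take_drop_id drop_Suc tl_drop)
    ultimately show "p \<in> (\<lambda>(q, r). q @ tl r) ` ?S"
      by (intro image_eqI[of _ _ "(?q, ?r)"]) auto
  qed
  moreover have fS: "finite ?S" using finite_saws[OF fin] by auto
  ultimately have "card (saws E v (m + n)) \<le> card ?S" by (rule surj_card_le[rotated])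
  also have "card ?S = (\<Sum>q\<in>saws E v m. card (saws E (last q) n))"
    using finite_saws[OF fin] by (simp add: card_SigmaI)
  finally have "real (card (saws E v (m + n))) \<le> (\<Sum>q\<in>saws E v m. real (card (saws E (last q) n)))"
    by (metis of_nat_le_iff of_nat_sum)
  also have "\<dots> \<le> (\<Sum>q\<in>saws E v m. B)"
  proof (intro sum_mono B)
    fix q assume q: "q \<in> saws E v m"
    then have "q \<noteq> []" by (auto simp: saws_eq)
    then show "last q \<in> V" using set_saw_subset[OF assms(1) v q] by auto
  qed
  finally show ?thesis by simp
qed

text \<open>Loop erasure: a step back to a vertex already on the path truncates the path
  there.\<close>

lemma saw_of_reachable:
  assumes "E\<^sup>*\<^sup>* v w"
  shows "\<exists>n p. p \<in> saws E v n \<and> last p = w"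
  using assms
proof induction
  case base
  show ?case by (rule exI[of _ 0], rule exI[of _ "[v]"]) (simp add: saws_eq)
next
  case (step y z)
  then obtain n p where p: "p \<in> saws E v n" "last p = y" by blast
  show ?case
  proof (cases "z \<in> set p")
    case True
    then obtain q r where q: "p = q @ z # r" by (auto simp: in_set_conv_decomp)
    have "q @ [z] \<in> saws E v (length q)"
      using p unfolding saws_eq q by (auto simp: successively_append_iff hd_append)
    then show ?thesis by (metis last_snoc)
  next
    case False
    have "p \<noteq> []" using p by (auto simp: saws_eq)
    then have "p @ [z] \<in> saws E v (Suc n)"
      using p step.hyps False by (auto simp: saws_eq successively_append_iff)
    then show ?thesis by (metis last_snoc)
  qed
qed

text \<open>Prefixes of self-avoiding walks are self-avoiding, so if length \<open>n\<close> fails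
  then every walk is shorter than \<open>n\<close>. Each vertex ends such a walk, and local
  finiteness leaves only finitely many of them.\<close>

lemma saws_nonempty:
  assumes fin: "\<And>v. finite {u. E v u}" and "graph_connected V E" "infinite V" "v \<in> V"
  shows "saws E v n \<noteq> {}"
proof
  assume e: "saws E v n = {}"
  have short: "m < n" if "p \<in> saws E v m" for m p
  proof (rule ccontr)
    assume "\<not> m < n"
    then have "take (Suc n) p \<in> saws E v n"
      using that by (auto simp: saws_eq successively_conv_nth)
    with e show False by simp
  qed
  have "V \<subseteq> last ` (\<Union>m<n. saws E v m)"
  proof
    fix w assume "w \<in> V"
    then have "E\<^sup>*\<^sup>* v w" using assms by (auto simp: graph_connected_def)
    from saw_of_reachable[OF this] short show "w \<in> last ` (\<Union>m<n. saws E v m)" by blast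
  qed
  then have "finite V" by (rule finite_subset) (use finite_saws[OF fin] in auto)
  with assms show False by simp
qed

text \<open>Follow the path \<open>\<gamma>\<close> until it first hits a given walk from \<open>w\<close>; continuing along either
  of the two arms of that walk gives two self-avoiding walks from \<open>v\<close>.\<close>

lemma card_saws_le_two_arms:
  assumes sym: "\<And>x y. E x y \<Longrightarrow> E y x" and fin: "\<And>v. finite {u. E v u}"
    and \<gamma>: "\<gamma> \<in> saws E v k" "last \<gamma> = w"
  shows "card (saws E w n) \<le>
    (\<Sum>i\<le>k. \<Sum>j\<le>n. card (saws E v (i + j)) * card (saws E v (i + (n - j))))"
proof -
  let ?S = "SIGMA i:{..k}. SIGMA j:{..n}. saws E v (i + j) \<times> saws E v (i + (n - j))"
  \<comment> \<open>Decoding: dropping the common prefix of length \<open>i\<close> leaves the two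
    arms, the first one running backwards to \<open>w\<close>. Both arms contain the junction
    vertex; \<open>take j\<close> removes the first copy.\<close>
  let ?d = "\<lambda>(i, j, A, B). take j (rev (drop i A)) @ drop i B"
  have \<gamma>': "length \<gamma> = Suc k" "hd \<gamma> = v" "distinct \<gamma>" "successively E \<gamma>"
    using \<gamma> by (auto simp: saws_eq)
  have sw: "saws E w n \<subseteq> ?d ` ?S"
  proof
    fix p assume p: "p \<in> saws E w n"
    have p': "length p = Suc n" "hd p = w" "distinct p" "successively E p"
      using p by (auto simp: saws_eq)
    define i where "i = (LEAST i. i \<le> k \<and> \<gamma> ! i \<in> set p)"
    have "k \<le> k \<and> \<gamma> ! k \<in> set p"
    proof -
      have "\<gamma> \<noteq> []" "p \<noteq> []" using \<gamma>'(1) p'(1) by auto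
      then have "\<gamma> ! k = hd p" using \<gamma>(2) \<gamma>'(1) p'(2) by (simp add: last_conv_nth)
      then show ?thesis using \<open>p \<noteq> []\<close> by simp
    qed
    then have i: "i \<le> k \<and> \<gamma> ! i \<in> set p"
      unfolding i_def by (rule LeastI)
    have i_min: "\<gamma> ! l \<notin> set p" if "l < i" for l
      using that not_less_Least[of l "\<lambda>i. i \<le> k \<and> \<gamma> ! i \<in> set p"] i unfolding i_def[symmetric]
      by auto
    obtain j where j: "j \<le> n" "p ! j = \<gamma> ! i"
      using i p'(1) by (metis in_set_conv_nth less_Suc_eq_le)
    let ?t = "take i \<gamma>"
    have disj: "set ?t \<inter> set p = {}"
      using i_min \<gamma>' i by (auto simp: in_set_conv_nth)
    have sub: "set (rev (take (Suc j) p)) \<subseteq> set p" "set (drop j p) \<subseteq> set p"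
      by (auto dest: in_set_takeD in_set_dropD)
    have st: "successively E ?t" "distinct ?t" "length ?t = i"
      using \<gamma>' i by (auto simp: successively_conv_nth)
    have hdr: "hd (drop j p) = \<gamma> ! i" "hd (rev (take (Suc j) p)) = \<gamma> ! i"
      using j p' by (auto simp: hd_drop_conv_nth hd_rev last_take_Suc)
    have ext: "?t @ q \<in> saws E v (i + l)"
      if "successively E q" "distinct q" "set q \<subseteq> set p" "hd q = \<gamma> ! i" "length q = Suc l" for q l
    proof -
      have "hd (?t @ q) = v"
        using \<gamma>' that by (cases \<gamma>; cases i) (auto simp: hd_append)
      moreover have "?t = [] \<or> E (last ?t) (hd q)"
      proof (cases i)
        case (Suc i')
        then show ?thesis using that \<gamma>' i by (auto simp: last_take_Suc successively_conv_nth)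
      qed simp
      ultimately show ?thesis
        using that st disj by (auto simp: saws_eq successively_append_iff)
    qed
    have "?t @ rev (take (Suc j) p) \<in> saws E v (i + j)"
    proof (rule ext)
      show "successively E (rev (take (Suc j) p))"
        unfolding successively_rev
      proof (rule successively_mono[of E])
        show "successively E (take (Suc j) p)"
          using p' j by (auto simp: successively_conv_nth)
      qed (rule sym)
    qed (use p' sub hdr j in auto)
    moreover have "?t @ drop j p \<in> saws E v (i + (n - j))"
    proof (rule ext)
      show "successively E (drop j p)"
        using p' by (auto simp: successively_conv_nth)
    qed (use p' sub hdr j in auto)
    moreover have "p = ?d (i, j, ?t @ rev (take (Suc j) p), ?t @ drop j p)"
      using st p' j by simp
    ultimately show "p \<in> ?d ` ?S"
      using i j by (intro image_eqI[of _ _ "(i, j, ?t @ rev (take (Suc j) p), ?t @ drop j p)"]) auto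
  qed
  have fS: "finite ?S" using finite_saws[OF fin] by (intro finite_SigmaI) auto
  from surj_card_le[OF fS sw] have "card (saws E w n) \<le> card ?S" .
  also have "card ?S = (\<Sum>i\<le>k. \<Sum>j\<le>n. card (saws E v (i + j)) * card (saws E v (i + (n - j))))"
    using finite_saws[OF fin] by (simp add: card_SigmaI card_cartesian_product)
  finally show ?thesis .
qed

lemma card_saws_aut_le:
  assumes "simple_graph V E" and fin: "\<And>v. finite {u. E v u}" and f: "is_aut V E f" and v: "v \<in> V"
  shows "card (saws E v n) \<le> card (saws E (f v) n)"
proof (rule card_inj_on_le[where f = "map f"])
  have inj: "inj_on f V" using f by (auto simp: is_aut_def bij_betw_def)
  have sub: "set p \<subseteq> V" if "p \<in> saws E v n" for p
    using set_saw_subset[OF assms(1) v that] .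
  show "inj_on (map f) (saws E v n)"
  proof (rule inj_onI)
    fix p q assume "p \<in> saws E v n" "q \<in> saws E v n" "map f p = map f q"
    then show "p = q"
      using sub[of p] sub[of q] inj by (metis inj_on_subset map_inj_on le_sup_iff)
  qed
  show "map f ` saws E v n \<subseteq> saws E (f v) n"
  proof safe
    fix p assume p: "p \<in> saws E v n"
    have "distinct (map f p)"
      using p sub[OF p] inj by (auto simp: saws_eq distinct_map inj_on_subset)
    moreover have "successively E (map f p)"
      unfolding successively_map
    proof (rule successively_mono[of E])
      show "successively E p" using p by (simp add: saws_eq)
      show "E (f x) (f y)" if "x \<in> set p" "y \<in> set p" "E x y" for x y
        using f that sub[OF p] by (auto simp: is_aut_def)
    qed
    ultimately show "map f p \<in> saws E (f v) n"
      using p by (cases p) (auto simp: saws_eq)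
  qed
  show "finite (saws E (f v) n)" by (rule finite_saws[OF fin])
qed

section \<open>The connective constant of a quasi-transitive graph\<close>

lemma ex_ge_average:
  fixes f :: "'a \<Rightarrow> real"
  assumes "finite A" "A \<noteq> {}" "S \<le> sum f A"
  shows "\<exists>x\<in>A. S \<le> real (card A) * f x"
proof (rule ccontr)
  assume *: "\<not> ?thesis"
  have pos: "card A > 0" using assms by (simp add: card_gt_0_iff)
  then have "f x < S / real (card A)" if "x \<in> A" for x
    using * that by (simp add: not_le field_simps)
  then have "sum f A < real (card A) * (S / real (card A))"
    by (rule sum_bounded_above_strict) (use pos in auto)
  with assms pos show False by simp
qed

text \<open>Averaging over linearly many lengths costs a factor \<open>2 * real m + 1\<close>; by
  Bernoulli any exponential gain \<open>t ^ m\<close> pays for it.\<close>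

lemma power_ge_linear:
  fixes t :: real
  assumes "t > 1"
  shows "\<exists>c>0. \<forall>m. c * (2 * real m + 1) \<le> t ^ m"
proof (intro exI conjI allI)
  define c where "c = min 1 ((t - 1) / 2)"
  have c: "c \<le> 1" "2 * c \<le> t - 1" by (auto simp: c_def min_def)
  show "c > 0" using assms by (simp add: c_def)
  fix m :: nat
  have "c * (2 * real m + 1) = c + (2 * c) * real m" by (simp add: algebra_simps)
  also have "\<dots> \<le> 1 + (t - 1) * real m"
    using c by (intro add_mono mult_right_mono) auto
  also have "\<dots> \<le> t ^ m"
    using Bernoulli_inequality[of "t - 1" m] assms by (simp add: mult.commute)
  finally show "c * (2 * real m + 1) \<le> t ^ m" .
qed

text \<open>Fekete's lemma as a pair of bounds. With \<open>l\<close> the infimum of the roots, the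
  lower bound needs no constant; for the upper one, some \<open>N\<close> has
  \<open>s N \<le> R ^ N\<close>, blocks of length \<open>N\<close> are split off, and
  \<open>C\<close> covers the remainders below \<open>N\<close>.\<close>

lemma submultiplicative_growth:
  fixes s :: "nat \<Rightarrow> real"
  assumes s1: "\<And>n. 1 \<le> s n" and sub: "\<And>m n. s (m + n) \<le> s m * s n"
  obtains l where "1 \<le> l" "\<And>n. l ^ n \<le> s n" "\<And>R. l < R \<Longrightarrow> \<exists>C>0. \<forall>n. s n \<le> C * R ^ n"
proof
  define l where "l = (INF n\<in>{1..}. root n (s n))"
  have bdd: "bdd_below ((\<lambda>n. root n (s n)) ` {1..})"
    by (rule bdd_belowI[of _ 0]) (use s1 order_trans[OF zero_le_one s1] in auto)
  show l1: "1 \<le> l"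
    unfolding l_def using s1 by (intro cINF_greatest) auto
  show "l ^ n \<le> s n" for n
  proof (cases "n = 0")
    case True then show ?thesis using s1 by simp
  next
    case False
    then have "l \<le> root n (s n)" unfolding l_def by (intro cINF_lower[OF bdd]) auto
    then have "l ^ n \<le> root n (s n) ^ n" using l1 by (intro power_mono) auto
    then show ?thesis using False s1 order_trans[OF zero_le_one s1] by simp
  qed
  show "\<exists>C>0. \<forall>n. s n \<le> C * R ^ n" if R: "l < R" for R
  proof -
    have "\<exists>N\<in>{1..}. root N (s N) < R"
      using R bdd unfolding l_def by (subst (asm) cINF_less_iff) auto
    then obtain N where N: "N \<ge> 1" "root N (s N) < R" by auto
    have "s N = root N (s N) ^ N" using N order_trans[OF zero_le_one s1] by simp
    also have "\<dots> \<le> R ^ N" using N order_trans[OF zero_le_one s1] by (intro power_mono) auto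
    finally have sN: "s N \<le> R ^ N" .
    define C where "C = (\<Sum>i<N. s i)"
    have s0: "0 \<le> s i" for i using s1[of i] by linarith
    have C: "s i \<le> C" if "i < N" for i
      unfolding C_def using that s0 by (intro member_le_sum) auto
    have "C > 0" using C[of 0] N s1[of 0] by simp
    moreover have "s n \<le> C * R ^ n" for n
    proof (induction n rule: less_induct)
      case (less n)
      show ?case
      proof (cases "n < N")
        case True
        have "s n \<le> C * 1" using C[OF True] by simp
        also have "\<dots> \<le> C * R ^ n"
          using R l1 \<open>C > 0\<close> by (intro mult_left_mono one_le_power) auto
        finally show ?thesis .
      next
        case False
        then have "s n \<le> s N * s (n - N)" using sub[of N "n - N"] by simp
        also have "\<dots> \<le> R ^ N * (C * R ^ (n - N))"
          using sN s0 R l1 False N less[of "n - N"] by (intro mult_mono) auto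
        also have "\<dots> = C * R ^ n" using False by (simp add: power_add[symmetric])
        finally show ?thesis .
      qed
    qed
    ultimately show ?thesis by blast
  qed
qed

text \<open>The maximum \<open>s\<close> over the fundamental domain is submultiplicative and
  dominates every vertex. A lower bound at a given \<open>v\<close> is the difficulty: the vertex
  attaining \<open>s n\<close> varies with \<open>n\<close>, but it lies within bounded distance of
  \<open>v\<close>, and the two-arm estimate transfers its walks to \<open>v\<close>.\<close>

theorem saws_growth_quasi_transitive:
  assumes G: "simple_graph V E" and inf: "infinite V" and con: "graph_connected V E"
    and qt: "quasi_transitive V E" and fin: "\<And>v. finite {u. E v u}"
  obtains \<mu> where "1 \<le> \<mu>"
    "\<And>R. \<mu> < R \<Longrightarrow> \<exists>C>0. \<forall>n. \<forall>v\<in>V. real (card (saws E v n)) \<le> C * R ^ n"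
    "\<And>v. v \<in> V \<Longrightarrow> (\<lambda>n. root n (real (card (saws E v n)))) \<longlonglongrightarrow> \<mu>"
proof -
  obtain W where W: "finite W" "W \<subseteq> V" "\<And>v. v \<in> V \<Longrightarrow> \<exists>f. is_aut V E f \<and> f v \<in> W"
    using qt unfolding quasi_transitive_def by blast
  obtain v0 where "v0 \<in> V" using inf by (metis ex_in_conv finite.emptyI)
  then have W0: "W \<noteq> {}" using W(3) by blast
  define s where "s n = Max ((\<lambda>w. real (card (saws E w n))) ` W)" for n
  have s_ub: "real (card (saws E v n)) \<le> s n" if v: "v \<in> V" for v n
  proof -
    obtain f where f: "is_aut V E f" "f v \<in> W" using W(3)[OF v] by blast
    have "card (saws E v n) \<le> card (saws E (f v) n)" by (rule card_saws_aut_le[OF G fin f(1) v])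
    also have "real (card (saws E (f v) n)) \<le> s n" unfolding s_def using W(1) f(2) by simp
    finally show ?thesis by simp
  qed
  have s_att: "\<exists>w\<in>W. s n = real (card (saws E w n))" for n
  proof -
    have "s n \<in> (\<lambda>w. real (card (saws E w n))) ` W"
      unfolding s_def using W(1) W0 by (intro Max_in) auto
    then show ?thesis by auto
  qed
  have s1: "1 \<le> s n" for n
  proof -
    have "card (saws E v0 n) > 0"
      using saws_nonempty[OF fin con inf \<open>v0 \<in> V\<close>] finite_saws[OF fin] by (simp add: card_gt_0_iff)
    then show ?thesis using s_ub[OF \<open>v0 \<in> V\<close>, of n] by linarith
  qed
  have sub: "s (m + n) \<le> s m * s n" for m n
  proof -
    obtain w where w: "w \<in> W" "s (m + n) = real (card (saws E w (m + n)))" using s_att by blast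
    then have wV: "w \<in> V" using W by auto
    have "s (m + n) \<le> real (card (saws E w m)) * s n"
      unfolding w(2) by (rule card_saws_add_le[OF G fin wV s_ub])
    also have "\<dots> \<le> s m * s n" using s_ub[OF wV] s1[of n] by (intro mult_right_mono) auto
    finally show ?thesis .
  qed
  obtain \<mu> where \<mu>: "1 \<le> \<mu>" "\<And>n. \<mu> ^ n \<le> s n" "\<And>R. \<mu> < R \<Longrightarrow> \<exists>C>0. \<forall>n. s n \<le> C * R ^ n"
    using submultiplicative_growth[OF s1 sub] by blast
  show ?thesis
  proof (rule that[of \<mu>])
    show "1 \<le> \<mu>" by fact
    show "\<exists>C>0. \<forall>n. \<forall>v\<in>V. real (card (saws E v n)) \<le> C * R ^ n" if "\<mu> < R" for R
      using \<mu>(3)[OF that] s_ub order_trans by meson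
    fix v assume v: "v \<in> V"
    have "\<forall>w\<in>W. \<exists>k \<gamma>. \<gamma> \<in> saws E v k \<and> last \<gamma> = w"
      using con v W(2) saw_of_reachable[of E v] unfolding graph_connected_def by blast
    then obtain k where k: "\<forall>w\<in>W. \<exists>\<gamma>. \<gamma> \<in> saws E v (k w) \<and> last \<gamma> = w" by metis
    define kk where "kk = (\<Sum>w\<in>W. k w)"
    have kk: "k w \<le> kk" if "w \<in> W" for w
      unfolding kk_def using that W(1) by (intro member_le_sum) auto
    define a where "a n = real (card (saws E v n))" for n
    have a0: "0 \<le> a n" for n by (simp add: a_def)
    \<comment> \<open>A walk of length \<open>2 * m\<close> is split, so the longer arm contributes
      at least \<open>m\<close> steps. Both arms share a prefix of at most \<open>kk\<close> steps,
      which gives the remaining bounds on \<open>p\<close> and \<open>q\<close>.\<close>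
    have arms: "\<exists>p q. m \<le> p \<and> p \<le> 2 * m + kk \<and> p + q \<le> 2 * m + 2 * kk \<and>
        \<mu> ^ (2 * m) \<le> (real kk + 1) * (2 * real m + 1) * (a p * a q)" for m
    proof -
      obtain w where w: "w \<in> W" "s (2 * m) = real (card (saws E w (2 * m)))" using s_att by blast
      obtain \<gamma> where \<gamma>: "\<gamma> \<in> saws E v (k w)" "last \<gamma> = w" using k w by blast
      let ?A = "{..k w} \<times> {..2 * m}"
      let ?f = "\<lambda>(i, j). a (i + j) * a (i + (2 * m - j))"
      have "\<mu> ^ (2 * m) \<le> real (card (saws E w (2 * m)))" using \<mu>(2)[of "2 * m"] w by simp
      also have "\<dots> \<le> (\<Sum>i\<le>k w. \<Sum>j\<le>2 * m. a (i + j) * a (i + (2 * m - j)))"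
        using of_nat_mono[OF card_saws_le_two_arms[OF _ fin \<gamma>, of "2 * m"], where 'a = real] G
        unfolding a_def by (simp add: simple_graph_def)
      also have "\<dots> = sum ?f ?A" by (rule sum.cartesian_product)
      finally have "\<exists>x\<in>?A. \<mu> ^ (2 * m) \<le> real (card ?A) * ?f x"
        by (intro ex_ge_average) auto
      then obtain i j where ij: "i \<le> k w" "j \<le> 2 * m"
        "\<mu> ^ (2 * m) \<le> real (card ?A) * (a (i + j) * a (i + (2 * m - j)))" by auto
      have "real (card ?A) = (real (k w) + 1) * (2 * real m + 1)"
        by (simp add: card_cartesian_product algebra_simps)
      also have "\<dots> \<le> (real kk + 1) * (2 * real m + 1)"
        using kk[OF w(1)] by (intro mult_right_mono) auto
      finally have "real (card ?A) * (a (i + j) * a (i + (2 * m - j)))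
          \<le> (real kk + 1) * (2 * real m + 1) * (a (i + j) * a (i + (2 * m - j)))"
        using a0 by (intro mult_right_mono) auto
      with ij have *: "\<mu> ^ (2 * m) \<le> (real kk + 1) * (2 * real m + 1) * (a (i + j) * a (i + (2 * m - j)))"
        by linarith
      show ?thesis
      proof (cases "m \<le> j")
        case True
        then show ?thesis using * ij kk[OF w(1)]
          by (intro exI[of _ "i + j"] exI[of _ "i + (2 * m - j)"]) auto
      next
        case False
        then show ?thesis using * ij kk[OF w(1)]
          by (intro exI[of _ "i + (2 * m - j)"] exI[of _ "i + j"]) (auto simp: mult.commute)
      qed
    qed
    show "(\<lambda>n. root n (real (card (saws E v n)))) \<longlonglongrightarrow> \<mu>"
      unfolding a_def[symmetric]
    proof (rule tendsto_root_if_sparse_lower_bound[where K = "kk + 2"])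
      show "0 < \<mu>" using \<mu>(1) by simp
      show "0 \<le> a n" for n by (rule a0)
      show "\<exists>C. \<forall>m n. a (m + n) \<le> a m * (C * r ^ n)" if r: "\<mu> < r" for r
      proof -
        obtain C where C: "\<forall>n. s n \<le> C * r ^ n" using \<mu>(3)[OF r] by blast
        then have "a (m + n) \<le> a m * (C * r ^ n)" for m n
          unfolding a_def using s_ub order_trans by (intro card_saws_add_le[OF G fin v]) blast
        then show ?thesis by blast
      qed
      fix r assume r: "0 < r" "r < \<mu>"
      \<comment> \<open>The other arm is bounded by \<open>C * R ^ q\<close>. As \<open>q\<close> is
        at most \<open>2 * m + 2 * kk - p\<close>, reaching \<open>r ^ p\<close> needs
        \<open>\<mu> ^ (2 * m) * R ^ p\<close> to beat \<open>R ^ (2 * m) * r ^ p\<close>. By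
        \<open>m \<le> p\<close> and \<open>r \<le> R\<close> the quotient is at least
        \<open>(\<mu>\<^sup>2 / (R * r)) ^ m\<close>, so \<open>R\<close> is chosen to make this
        base, called \<open>t\<close> below, exceed 1.\<close>
      have "\<mu> < \<mu>\<^sup>2 / r" using r by (simp add: field_simps power2_eq_square)
      then obtain R where R: "\<mu> < R" "R < \<mu>\<^sup>2 / r" using dense by blast
      then have R1: "1 \<le> R" "r \<le> R" using \<mu>(1) r by auto
      obtain C where C: "C > 0" "\<And>n. s n \<le> C * R ^ n" using \<mu>(3)[OF R(1)] by blast
      define t where "t = \<mu>\<^sup>2 / (R * r)"
      have t: "t > 1" using R r R1 by (simp add: t_def field_simps)
      obtain c where c: "c > 0" "\<And>m. c * (2 * real m + 1) \<le> t ^ m"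
        using power_ge_linear[OF t] by blast
      define D where "D = (real kk + 1) * C * R ^ (2 * kk)"
      have D: "D > 0" using C R1 by (simp add: D_def)
      have "\<exists>n. m \<le> n \<and> n \<le> (kk + 2) * m + (kk + 2) \<and> (c / D) * r ^ n \<le> a n" for m
      proof -
        obtain p q where pq: "m \<le> p" "p \<le> 2 * m + kk" "p + q \<le> 2 * m + 2 * kk"
          "\<mu> ^ (2 * m) \<le> (real kk + 1) * (2 * real m + 1) * (a p * a q)" using arms by blast
        have aq: "a q \<le> C * R ^ q" unfolding a_def using s_ub[OF v] C(2) order_trans by blast
        have "c * (2 * real m + 1) * (R ^ (2 * m) * r ^ p) \<le> t ^ m * (R ^ (2 * m) * r ^ p)"
          using c(2) R1 r by (intro mult_right_mono) auto
        also have "\<dots> = t ^ m * R ^ m * r ^ m * (R ^ m * r ^ (p - m))"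
        proof -
          have "r ^ p = r ^ m * r ^ (p - m)" using pq(1) by (simp flip: power_add)
          then show ?thesis by (simp add: mult_2 power_add)
        qed
        also have "\<dots> \<le> t ^ m * R ^ m * r ^ m * (R ^ m * R ^ (p - m))"
          using R1 r t by (intro mult_left_mono power_mono) auto
        also have "\<dots> = \<mu> ^ (2 * m) * R ^ p"
        proof -
          have "t * R * r = \<mu>\<^sup>2" using r R1 by (simp add: t_def)
          then have "t ^ m * R ^ m * r ^ m = \<mu> ^ (2 * m)"
            by (metis power_mult power_mult_distrib)
          moreover have "R ^ m * R ^ (p - m) = R ^ p" using pq(1) by (simp flip: power_add)
          ultimately show ?thesis by simp
        qed
        also have "\<dots> \<le> (real kk + 1) * (2 * real m + 1) * (a p * a q) * R ^ p"
          using pq(4) R1 by (intro mult_right_mono) auto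
        also have "\<dots> \<le> (real kk + 1) * (2 * real m + 1) * (a p * (C * R ^ q)) * R ^ p"
          using aq R1 a0 by (intro mult_right_mono mult_left_mono) auto
        also have "\<dots> = (real kk + 1) * (2 * real m + 1) * a p * C * R ^ (p + q)"
          by (simp add: power_add)
        also have "\<dots> \<le> (real kk + 1) * (2 * real m + 1) * a p * C * R ^ (2 * m + 2 * kk)"
          using pq(3) R1 a0 C(1) by (intro mult_left_mono power_increasing) auto
        also have "\<dots> = (2 * real m + 1) * R ^ (2 * m) * (D * a p)"
          by (simp add: D_def power_add)
        finally have "((2 * real m + 1) * R ^ (2 * m)) * (c * r ^ p)
            \<le> ((2 * real m + 1) * R ^ (2 * m)) * (D * a p)" by (simp add: mult_ac)
        then have "c * r ^ p \<le> D * a p"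
          by (rule mult_left_le_imp_le) (use R1 in auto)
        then have "(c / D) * r ^ p \<le> a p" using D by (simp add: field_simps)
        moreover have "p \<le> (kk + 2) * m + (kk + 2)" using pq(2) by (simp add: algebra_simps)
        ultimately show ?thesis using pq(1) by blast
      qed
      then show "\<exists>c>0. \<forall>\<^sub>F m in sequentially.
          \<exists>n. m \<le> n \<and> n \<le> (kk + 2) * m + (kk + 2) \<and> c * r ^ n \<le> a n"
        using c(1) D by (intro exI[of _ "c / D"]) simp
    qed
  qed
qed

section \<open>Gadget series and lifted walks\<close>

lemma gadget_path_subset:
  assumes "simple_graph \<Gamma> Eg" "q \<in> gadget_paths Eg a b"
  shows "set q \<subseteq> insert a \<Gamma>"
proof -
  have "successively Eg q \<Longrightarrow> q \<noteq> [] \<Longrightarrow> set q \<subseteq> insert (hd q) \<Gamma>" for q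
    using assms(1) by (induction q rule: induct_list012) (auto simp: simple_graph_def)
  then show ?thesis using assms(2) by (auto simp: gadget_paths_eq)
qed

lemma finite_gadget_paths:
  assumes "simple_graph \<Gamma> Eg" "finite \<Gamma>"
  shows "finite (gadget_paths Eg a b)"
proof (rule finite_subset)
  show "gadget_paths Eg a b \<subseteq> {q. set q \<subseteq> insert a \<Gamma> \<and> distinct q}"
    using gadget_path_subset[OF assms(1)] by (auto simp: gadget_paths_eq)
  show "finite {q. set q \<subseteq> insert a \<Gamma> \<and> distinct q}"
    using assms(2) by (intro finite_subset_distinct) auto
qed

lemma gadget_paths_nonempty:
  assumes "graph_connected \<Gamma> Eg" "a \<in> \<Gamma>" "b \<in> \<Gamma>"
  shows "gadget_paths Eg a b \<noteq> {}"
proof -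
  have "Eg\<^sup>*\<^sup>* a b" using assms by (auto simp: graph_connected_def)
  from saw_of_reachable[OF this] obtain n p where "p \<in> saws Eg a n" "last p = b" by blast
  then have "p \<in> gadget_paths Eg a b" by (auto simp: saws_eq gadget_paths_eq)
  then show ?thesis by blast
qed

lemma gadget_series_commute:
  assumes "simple_graph \<Gamma> Eg"
  shows "gadget_series Eg a b x = gadget_series Eg b a x"
proof -
  have rev: "rev q \<in> gadget_paths Eg b a" if q: "q \<in> gadget_paths Eg a b" for q a b
  proof -
    have "successively (\<lambda>x y. Eg y x) q"
      by (rule successively_mono[of Eg]) (use q assms in \<open>auto simp: gadget_paths_eq simple_graph_def\<close>)
    then show ?thesis using q by (auto simp: gadget_paths_eq hd_rev last_rev)
  qed
  show ?thesis unfolding gadget_series_def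
    by (rule sum.reindex_bij_witness[of _ rev rev]) (use rev in auto)
qed

lemma gadget_series_aut_le:
  assumes G: "simple_graph \<Gamma> Eg" "finite \<Gamma>" and f: "is_aut \<Gamma> Eg f" and a: "a \<in> \<Gamma>" and x: "0 \<le> x"
  shows "gadget_series Eg a b x \<le> gadget_series Eg (f a) (f b) x"
proof -
  let ?P = "gadget_paths Eg"
  have inj: "inj_on f \<Gamma>" using f by (auto simp: is_aut_def bij_betw_def)
  have sub: "set q \<subseteq> \<Gamma>" if "q \<in> ?P a b" for q
    using gadget_path_subset[OF G(1) that] a by auto
  have "inj_on (map f) (?P a b)"
  proof (rule inj_onI)
    fix p q assume "p \<in> ?P a b" "q \<in> ?P a b" "map f p = map f q"
    then show "p = q"
      using sub[of p] sub[of q] inj by (metis inj_on_subset map_inj_on le_sup_iff)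
  qed
  then have "gadget_series Eg a b x = (\<Sum>q\<in>map f ` ?P a b. x ^ length q)"
    unfolding gadget_series_def by (simp add: sum.reindex)
  also have "\<dots> \<le> gadget_series Eg (f a) (f b) x"
    unfolding gadget_series_def
  proof (rule sum_mono2)
    show "map f ` ?P a b \<subseteq> ?P (f a) (f b)"
    proof safe
      fix q assume q: "q \<in> ?P a b"
      have "distinct (map f q)"
        using q sub[OF q] inj by (auto simp: gadget_paths_eq distinct_map inj_on_subset)
      moreover have "successively Eg (map f q)"
        unfolding successively_map
      proof (rule successively_mono[of Eg])
        show "successively Eg q" using q by (simp add: gadget_paths_eq)
        show "Eg (f x) (f y)" if "x \<in> set q" "y \<in> set q" "Eg x y" for x y
          using f that sub[OF q] by (auto simp: is_aut_def)
      qed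
      ultimately show "map f q \<in> ?P (f a) (f b)"
        using q by (auto simp: gadget_paths_eq hd_map last_map)
    qed
  qed (use finite_gadget_paths[OF G] x in auto)
  finally show ?thesis .
qed

lemma is_gadgetD:
  assumes "is_gadget \<Gamma> Eg w1 w2 w3"
  shows "finite \<Gamma>" "simple_graph \<Gamma> Eg" "graph_connected \<Gamma> Eg" "w1 \<in> \<Gamma>" "w2 \<in> \<Gamma>" "w3 \<in> \<Gamma>"
    "w1 \<noteq> w2" "w1 \<noteq> w3" "w2 \<noteq> w3"
  using assms by (simp_all add: is_gadget_def)

text \<open>An unordered pair of ports is determined by the third port, so transitivity on ports
  yields transitivity on pairs of ports.\<close>

lemma gadget_series_ports:
  assumes gad: "is_gadget \<Gamma> Eg w1 w2 w3" and ab: "a \<in> {w1, w2, w3}" "b \<in> {w1, w2, w3}" "a \<noteq> b"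
    and x: "0 \<le> x"
  shows "gadget_series Eg a b x = gadget_series Eg w1 w2 x"
proof -
  let ?g = "\<lambda>a b. gadget_series Eg a b x"
  let ?W = "{w1, w2, w3}"
  have G: "simple_graph \<Gamma> Eg" "finite \<Gamma>" "?W \<subseteq> \<Gamma>"
    and d: "w1 \<noteq> w2" "w1 \<noteq> w3" "w2 \<noteq> w3"
    using is_gadgetD[OF gad] by simp_all
  obtain H where "H \<subseteq> {f. is_aut \<Gamma> Eg f \<and> f \<in> extensional \<Gamma>}"
    "\<forall>f\<in>H. f ` ?W = ?W" "\<forall>a\<in>?W. \<forall>b\<in>?W. \<exists>f\<in>H. f a = b"
    using gad unfolding is_gadget_def by (elim conjE exE) (rule that; assumption)
  then have H: "\<And>f. f \<in> H \<Longrightarrow> is_aut \<Gamma> Eg f" "\<And>f. f \<in> H \<Longrightarrow> f ` ?W = ?W"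
    "\<And>a b. a \<in> ?W \<Longrightarrow> b \<in> ?W \<Longrightarrow> \<exists>f\<in>H. f a = b"
    by (auto simp only: Ball_def mem_Collect_eq subset_eq)
  \<comment> \<open>One inequality suffices, as it can be applied with the two pairs exchanged. The
    automorphism taking \<open>c\<close> to \<open>c'\<close> may swap the other two ports, which
    reversal of paths repairs.\<close>
  have le: "?g a b \<le> ?g a' b'"
    if W: "?W = {a, b, c}" "?W = {a', b', c'}" and ne: "a \<noteq> b" "a \<noteq> c" "b \<noteq> c" "a' \<noteq> c'" "b' \<noteq> c'"
      for a b c a' b' c'
  proof -
    obtain f where f: "f \<in> H" "f c = c'" using H(3)[of c c', unfolded W(1)] W(2)[unfolded W(1)] by blast
    have inj: "inj_on f \<Gamma>" using H(1)[OF f(1)] by (auto simp: is_aut_def bij_betw_def)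
    have in\<Gamma>: "a \<in> \<Gamma>" "b \<in> \<Gamma>" "c \<in> \<Gamma>" using W(1) G(3) by auto
    have "f a \<noteq> f b" "f a \<noteq> f c" "f b \<noteq> f c"
      using inj in\<Gamma> ne by (auto dest: inj_onD)
    moreover have "f a \<in> {a', b', c'}" "f b \<in> {a', b', c'}"
    proof -
      have "f ` {a, b, c} = {a', b', c'}"
        using H(2)[OF f(1)] unfolding W(1)[symmetric] W(2)[symmetric] .
      moreover have "f a \<in> f ` {a, b, c}" "f b \<in> f ` {a, b, c}" by simp_all
      ultimately show "f a \<in> {a', b', c'}" "f b \<in> {a', b', c'}" by (simp_all only:)
    qed
    ultimately have "f a = a' \<and> f b = b' \<or> f a = b' \<and> f b = a'" using f(2) by auto
    moreover have "?g a b \<le> ?g (f a) (f b)"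
      by (rule gadget_series_aut_le[OF G(1,2) H(1)[OF f(1)] in\<Gamma>(1) x])
    ultimately show ?thesis using gadget_series_commute[OF G(1)] by metis
  qed
  have "?W = {a, b, w3} \<and> a \<noteq> w3 \<and> b \<noteq> w3 \<or> ?W = {a, b, w2} \<and> a \<noteq> w2 \<and> b \<noteq> w2 \<or>
      ?W = {a, b, w1} \<and> a \<noteq> w1 \<and> b \<noteq> w1"
    using ab d by auto
  then obtain c where c: "?W = {a, b, c}" "a \<noteq> c" "b \<noteq> c" by metis
  show ?thesis
    using le[OF c(1) refl ab(3) c(2,3) d(2,3)] le[OF refl c(1) d c(2,3)] by simp
qed

text \<open>This is the part of self-avoidance that projected walks retain everywhere, even at their
  ends. It says that an interior gadget is left through a port other than the one of entry, which is
  what makes its factor equal to the gadget series.\<close>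

fun nonbacktracking :: "'a list \<Rightarrow> bool" where
  "nonbacktracking (u # v # w # p) \<longleftrightarrow> u \<noteq> w \<and> nonbacktracking (v # w # p)"
| "nonbacktracking _ \<longleftrightarrow> True"

lemma nonbacktracking_if_distinct: "distinct p \<Longrightarrow> nonbacktracking p"
  by (induction p rule: nonbacktracking.induct) auto

section \<open>Ports, and walks lifted to the transformed graph\<close>

locale gadget_substitution =
  fixes V :: "'a set" and E :: "'a \<Rightarrow> 'a \<Rightarrow> bool"
    and \<Gamma> :: "'b set" and Eg :: "'b \<Rightarrow> 'b \<Rightarrow> bool" and w1 w2 w3 :: 'b
    and port :: "'a \<Rightarrow> 'a \<Rightarrow> 'b"
  assumes simple: "simple_graph V E" and cubic: "cubic V E"
    and transformation: "is_local_transformation V E \<Gamma> Eg w1 w2 w3 port"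
begin

abbreviation "E1 \<equiv> tf_edges V E \<Gamma> Eg port"

lemma gadget: "finite \<Gamma>" "simple_graph \<Gamma> Eg" "graph_connected \<Gamma> Eg" "w1 \<in> \<Gamma>" "w2 \<in> \<Gamma>" "w3 \<in> \<Gamma>"
  using is_gadgetD[of \<Gamma> Eg w1 w2 w3] transformation by (simp_all add: is_local_transformation_def)

lemma edge: "E u v \<Longrightarrow> u \<in> V \<and> v \<in> V \<and> u \<noteq> v \<and> E v u"
  using simple by (auto simp: simple_graph_def)

lemma degree: "v \<in> V \<Longrightarrow> card {u. E v u} = 3"
  using cubic by (auto simp: cubic_def)

lemma finite_neighbours: "finite {u. E v u}"
proof (cases "v \<in> V")
  case True
  then show ?thesis using degree[of v] by (intro card_ge_0_finite) simp
next
  case False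
  then have "{u. E v u} = {}" using edge by auto
  then show ?thesis by (simp only: finite.emptyI)
qed

lemma port_in: assumes "E v u" shows "port v u \<in> {w1, w2, w3}" "port v u \<in> \<Gamma>"
proof -
  show "port v u \<in> {w1, w2, w3}"
    using transformation edge[OF assms] assms
    by (auto simp: is_local_transformation_def bij_betw_def)
  then show "port v u \<in> \<Gamma>" using gadget by auto
qed

lemma port_neq: "E v u \<Longrightarrow> E v w \<Longrightarrow> u \<noteq> w \<Longrightarrow> port v u \<noteq> port v w"
  using transformation edge[of v u]
  by (auto simp: is_local_transformation_def bij_betw_def dest!: bspec[of V _ v] dest: inj_onD)

abbreviation "gs x a b \<equiv> gadget_series Eg a b x"
abbreviation "gp a b \<equiv> gadget_paths Eg a b"

lemma gs_port:
  assumes "0 \<le> x" "E v u" "E v w" "u \<noteq> w"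
  shows "gs x (port v u) (port v w) = gs x w1 w2"
  using transformation port_in(1)[OF assms(2)] port_in(1)[OF assms(3)] port_neq[OF assms(2-)] assms(1)
  by (intro gadget_series_ports) (auto simp: is_local_transformation_def)

lemma finite_gp: "finite (gp a b)"
  using gadget by (intro finite_gadget_paths)

lemma gp_bounds:
  assumes "a \<in> \<Gamma>" "q \<in> gp a b"
  shows "set q \<subseteq> \<Gamma>" "1 \<le> length q" "length q \<le> card \<Gamma>"
proof -
  show s: "set q \<subseteq> \<Gamma>" using gadget_path_subset[OF gadget(2) assms(2)] assms(1) by auto
  show "1 \<le> length q" using assms(2) by (cases q) (auto simp: gadget_paths_eq)
  have "length q = card (set q)" using assms(2) by (auto simp: gadget_paths_eq distinct_card)
  also have "\<dots> \<le> card \<Gamma>" using s gadget by (intro card_mono)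
  finally show "length q \<le> card \<Gamma>" .
qed

lemma gs_nonneg: "0 \<le> x \<Longrightarrow> 0 \<le> gs x a b"
  unfolding gadget_series_def by (intro sum_nonneg) auto

text \<open>Controls the first and last gadget of a lifted walk, where an end may be any vertex
  instead of a port. A single path of at most \<open>card \<Gamma>\<close> vertices already gives
  the lower bound; \<open>min 1 x\<close> makes the power monotone whether or not \<open>x\<close>
  exceeds 1.\<close>

lemma gs_bounds:
  assumes x: "0 < x"
  shows "\<exists>\<delta> M. 0 < \<delta> \<and> \<delta> \<le> M \<and> (\<forall>a\<in>\<Gamma>. \<forall>b\<in>\<Gamma>. \<delta> \<le> gs x a b \<and> gs x a b \<le> M)"
proof -
  define \<delta> where "\<delta> = min 1 x ^ card \<Gamma>"
  define M where "M = (\<Sum>a\<in>\<Gamma>. \<Sum>b\<in>\<Gamma>. gs x a b)"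
  have "0 < \<delta>" using x by (simp add: \<delta>_def)
  moreover have *: "\<delta> \<le> gs x a b \<and> gs x a b \<le> M" if ab: "a \<in> \<Gamma>" "b \<in> \<Gamma>" for a b
  proof
    obtain q where q: "q \<in> gp a b" using gadget_paths_nonempty[OF gadget(3) ab] by blast
    have "\<delta> \<le> min 1 x ^ length q"
      unfolding \<delta>_def using gp_bounds[OF ab(1) q] x by (intro power_decreasing) auto
    also have "\<dots> \<le> x ^ length q" using x by (intro power_mono) auto
    also have "\<dots> \<le> gs x a b"
      unfolding gadget_series_def using q x finite_gp by (intro member_le_sum) auto
    finally show "\<delta> \<le> gs x a b" .
    have "gs x a b \<le> (\<Sum>b\<in>\<Gamma>. gs x a b)"
      using ab gadget gs_nonneg x by (intro member_le_sum) auto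
    also have "\<dots> \<le> M"
      unfolding M_def using ab gadget gs_nonneg x by (intro member_le_sum sum_nonneg) auto
    finally show "gs x a b \<le> M" .
  qed
  moreover have "\<delta> \<le> M" using *[OF gadget(4,5)] by linarith
  ultimately show ?thesis by blast
qed

text \<open>\<open>lifts b p c\<close> are the walks of the transformed graph over the walk \<open>p\<close> of the original one,
  entering the first gadget at \<open>b\<close> and ending at \<open>c\<close> in the last one;
  \<open>weight x b p c\<close> is their generating function when \<open>p\<close> has no repeated vertex.\<close>

fun lifts :: "'b \<Rightarrow> 'a list \<Rightarrow> 'b \<Rightarrow> ('a \<times> 'b) list set" where
  "lifts b [] c = {}"
| "lifts b [v] c = map (Pair v) ` gp b c"
| "lifts b (v # w # p) c =
     (\<lambda>(q, r). map (Pair v) q @ r) ` (gp b (port v w) \<times> lifts (port w v) (w # p) c)"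

fun weight :: "real \<Rightarrow> 'b \<Rightarrow> 'a list \<Rightarrow> 'b \<Rightarrow> real" where
  "weight x b [] c = 0"
| "weight x b [v] c = gs x b c"
| "weight x b (v # w # p) c = gs x b (port v w) * weight x (port w v) (w # p) c"

lemma finite_lifts: "finite (lifts b p c)"
  by (induction b p c rule: lifts.induct) (auto simp: finite_gp)

lemma sum_product_lifts:
  "(\<Sum>(q, r)\<in>gp b (port v w) \<times> lifts (port w v) (w # p) c. x ^ length (map (Pair v) q @ r))
     = gs x b (port v w) * (\<Sum>r\<in>lifts (port w v) (w # p) c. x ^ length r)"
  unfolding gadget_series_def
  by (simp add: sum.cartesian_product[symmetric] sum_product power_add)

text \<open>For an arbitrary list \<open>p\<close> nothing says that the decomposition of a lift is
  unique, but passing to an image can only lower a sum of nonnegative terms. The upper bound uses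
  this form, since projections may repeat vertices.\<close>

lemma sum_lifts_le_weight:
  assumes "0 \<le> x"
  shows "(\<Sum>\<pi>\<in>lifts b p c. x ^ length \<pi>) \<le> weight x b p c"
proof (induction b p c rule: lifts.induct)
  case (2 b v c)
  have "(\<Sum>\<pi>\<in>map (Pair v) ` gp b c. x ^ length \<pi>) \<le> (\<Sum>q\<in>gp b c. x ^ length (map (Pair v) q))"
    using assms finite_gp sum_image_le[of "gp b c" "\<lambda>\<pi>. x ^ length \<pi>" "map (Pair v)"]
    by (auto simp: o_def)
  then show ?case by (simp add: gadget_series_def)
next
  case (3 b v w p c)
  let ?h = "\<lambda>(q, r). map (Pair v) q @ r"
  let ?S = "gp b (port v w) \<times> lifts (port w v) (w # p) c"
  have "(\<Sum>\<pi>\<in>?h ` ?S. x ^ length \<pi>) \<le> (\<Sum>z\<in>?S. x ^ length (?h z))"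
    using assms finite_gp finite_lifts sum_image_le[of ?S "\<lambda>\<pi>. x ^ length \<pi>" ?h]
    by (auto simp: o_def)
  also have "\<dots> = (\<Sum>(q, r)\<in>?S. x ^ length (map (Pair v) q @ r))"
    by (intro sum.cong) auto
  also have "\<dots> = gs x b (port v w) * (\<Sum>r\<in>lifts (port w v) (w # p) c. x ^ length r)"
    by (rule sum_product_lifts)
  also have "\<dots> \<le> gs x b (port v w) * weight x (port w v) (w # p) c"
    using 3 gs_nonneg[OF assms] by (intro mult_left_mono)
  finally show ?case by simp
qed simp

lemma lifts_hd: "\<pi> \<in> lifts b p c \<Longrightarrow> \<pi> \<noteq> [] \<and> hd \<pi> = (hd p, b)"
  by (induction b p c arbitrary: \<pi> rule: lifts.induct) (auto simp: gadget_paths_eq hd_map hd_append)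

lemma lifts_fst: "\<pi> \<in> lifts b p c \<Longrightarrow> fst ` set \<pi> = set p"
proof (induction b p c arbitrary: \<pi> rule: lifts.induct)
  case (2 b v c)
  then show ?case by (auto simp: gadget_paths_eq image_image image_constant_conv)
next
  case (3 b v w p c)
  then obtain q r where "\<pi> = map (Pair v) q @ r" "q \<in> gp b (port v w)" "r \<in> lifts (port w v) (w # p) c"
    by auto
  moreover from this have "q \<noteq> []" by (auto simp: gadget_paths_eq)
  ultimately show ?case using "3.IH" by (auto simp: image_Un image_image image_constant_conv)
qed simp

lemma remdups_replicate_append:
  "n > 0 \<Longrightarrow> v \<notin> set xs \<Longrightarrow> remdups (replicate n v @ xs) = v # remdups xs"
proof (induction n)
  case (Suc n) then show ?case by (cases n) auto
qed simp

text \<open>A lift determines its base: over a \<open>distinct\<close> walk each vertex occupies one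
  contiguous block. Hence lifts of different self-avoiding walks are disjoint.\<close>

lemma lifts_base: "\<pi> \<in> lifts b p c \<Longrightarrow> distinct p \<Longrightarrow> remdups (map fst \<pi>) = p"
proof (induction b p c arbitrary: \<pi> rule: lifts.induct)
  case (2 b v c)
  then obtain q where "\<pi> = map (Pair v) q" "q \<noteq> []" by (auto simp: gadget_paths_eq)
  then show ?case using remdups_replicate_append[of "length q" v "[]"]
    by (simp add: o_def map_replicate_const)
next
  case (3 b v w p c)
  then obtain q r where *: "\<pi> = map (Pair v) q @ r" "q \<in> gp b (port v w)" "r \<in> lifts (port w v) (w # p) c"
    by auto
  then have "v \<notin> set (map fst r)" using lifts_fst[OF *(3)] "3.prems" by auto
  moreover have "length q > 0" using *(2) by (auto simp: gadget_paths_eq)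
  ultimately show ?case
    using "3.IH"[OF *(3)] "3.prems"(2) remdups_replicate_append[of "length q" v "map fst r"] *(1)
    by (simp add: o_def map_replicate_const)
qed simp

lemma sum_lifts_eq_weight:
  assumes "distinct p"
  shows "(\<Sum>\<pi>\<in>lifts b p c. x ^ length \<pi>) = weight x b p c"
  using assms
proof (induction b p c rule: lifts.induct)
  case (2 b v c)
  have "inj_on (map (Pair v)) (gp b c)" by (auto intro!: inj_onI simp: inj_map_eq_map inj_def)
  then show ?case by (simp add: sum.reindex gadget_series_def)
next
  case (3 b v w p c)
  let ?h = "\<lambda>(q, r). map (Pair v) q @ r"
  let ?S = "gp b (port v w) \<times> lifts (port w v) (w # p) c"
  \<comment> \<open>Since \<open>v\<close> does not recur in \<open>r\<close>, the first change of
    base vertex marks the cut, so \<open>q\<close> and \<open>r\<close> can be read off their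
    concatenation.\<close>
  have key: "map snd (takeWhile (\<lambda>z. fst z = v) (map (Pair v) q @ r)) = q"
    "dropWhile (\<lambda>z. fst z = v) (map (Pair v) q @ r) = r"
    if "r \<in> lifts (port w v) (w # p) c" for q r
  proof -
    have "v \<notin> fst ` set r" using lifts_fst[OF that] 3 by auto
    then have "takeWhile (\<lambda>z. fst z = v) r = []" "dropWhile (\<lambda>z. fst z = v) r = r"
      by (cases r; auto)+
    then show "map snd (takeWhile (\<lambda>z. fst z = v) (map (Pair v) q @ r)) = q"
      "dropWhile (\<lambda>z. fst z = v) (map (Pair v) q @ r) = r"
      by (simp add: takeWhile_append o_def, induction q) simp_all
  qed
  have inj: "inj_on ?h ?S"
    by (rule inj_onI) (clarsimp, metis key)
  have "(\<Sum>\<pi>\<in>?h ` ?S. x ^ length \<pi>) = (\<Sum>(q, r)\<in>?S. x ^ length (map (Pair v) q @ r))"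
    unfolding sum.reindex[OF inj] by (intro sum.cong) auto
  also have "\<dots> = gs x b (port v w) * weight x (port w v) (w # p) c"
    using 3 by (simp only: sum_product_lifts) simp
  finally show ?case by simp
qed simp

lemma length_lifts:
  "\<pi> \<in> lifts b p c \<Longrightarrow> b \<in> \<Gamma> \<Longrightarrow> successively E p \<Longrightarrow>
     length p \<le> length \<pi> \<and> length \<pi> \<le> card \<Gamma> * length p"
proof (induction b p c arbitrary: \<pi> rule: lifts.induct)
  case (2 b v c)
  then show ?case using gp_bounds by fastforce
next
  case (3 b v w p c)
  then obtain q r where *: "\<pi> = map (Pair v) q @ r" "q \<in> gp b (port v w)" "r \<in> lifts (port w v) (w # p) c"
    by auto
  have "port w v \<in> \<Gamma>" using "3.prems" edge port_in by auto
  then have "length (w # p) \<le> length r \<and> length r \<le> card \<Gamma> * length (w # p)"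
    using "3.IH"[OF *(3)] "3.prems" by auto
  then show ?case using gp_bounds[OF "3.prems"(2) *(2)] *(1) by auto
qed simp

lemma gp_walk:
  assumes "q \<in> gp b c" "b \<in> \<Gamma>" "v \<in> V"
  shows "successively E1 (map (Pair v) q)"
  unfolding successively_map
proof (rule successively_mono[of Eg])
  show "successively Eg q" using assms by (auto simp: gadget_paths_eq)
  show "E1 (v, x) (v, y)" if "x \<in> set q" "y \<in> set q" "Eg x y" for x y
    using that gp_bounds(1)[OF assms(2,1)] assms(3) by (auto simp: tf_edges_def)
qed

lemma lifts_walk:
  "\<pi> \<in> lifts b p c \<Longrightarrow> b \<in> \<Gamma> \<Longrightarrow> successively E p \<Longrightarrow> hd p \<in> V \<Longrightarrow> successively E1 \<pi>"
proof (induction b p c arbitrary: \<pi> rule: lifts.induct)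
  case (2 b v c)
  then show ?case using gp_walk by auto
next
  case (3 b v w p c)
  then obtain q r where *: "\<pi> = map (Pair v) q @ r" "q \<in> gp b (port v w)" "r \<in> lifts (port w v) (w # p) c"
    by auto
  have e: "E v w" "port w v \<in> \<Gamma>" "port v w \<in> \<Gamma>" "w \<in> V" "v \<in> V" using "3.prems" edge port_in by auto
  have "successively E1 r" using "3.IH"[OF *(3)] e "3.prems" by auto
  moreover have "last (map (Pair v) q) = (v, port v w)" "map (Pair v) q \<noteq> []"
    using *(2) by (auto simp: gadget_paths_eq last_map)
  moreover have "hd r = (w, port w v)" using lifts_hd[OF *(3)] by simp
  ultimately show ?case
    using gp_walk[OF *(2) "3.prems"(2) e(5)] e *(1)
    by (auto simp: successively_append_iff tf_edges_def)
qed simp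

lemma lifts_distinct: "\<pi> \<in> lifts b p c \<Longrightarrow> distinct p \<Longrightarrow> distinct \<pi>"
proof (induction b p c arbitrary: \<pi> rule: lifts.induct)
  case (2 b v c)
  then show ?case by (auto simp: gadget_paths_eq distinct_map inj_on_def)
next
  case (3 b v w p c)
  then obtain q r where *: "\<pi> = map (Pair v) q @ r" "q \<in> gp b (port v w)" "r \<in> lifts (port w v) (w # p) c"
    by auto
  have "v \<notin> fst ` set r" using lifts_fst[OF *(3)] "3.prems"(2) by auto
  then have "(v, y) \<notin> set r" for y by force
  then show ?case using *(2) "3.IH"[OF *(3)] "3.prems"(2) unfolding *(1)
    by (auto simp: gadget_paths_eq distinct_map inj_on_def)
qed simp

text \<open>The predecessor \<open>u\<close> is carried along so that the first gadget, too, is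
  entered through a port. Every gadget but the last is then crossed between two different ports; the
  last keeps its own factor because \<open>c\<close> is arbitrary.\<close>

lemma weight_port:
  assumes "0 \<le> x" "successively E (u # v # p)" "nonbacktracking (u # v # p)"
  shows "\<exists>b\<in>\<Gamma>. weight x (port v u) (v # p) c = gs x w1 w2 ^ length p * gs x b c"
  using assms(2,3)
proof (induction p arbitrary: u v)
  case Nil
  then have "port v u \<in> \<Gamma>" using edge port_in by auto
  then show ?case by auto
next
  case (Cons w p)
  then obtain b where "b \<in> \<Gamma>" "weight x (port w v) (w # p) c = gs x w1 w2 ^ length p * gs x b c"
    by (metis nonbacktracking.simps(1) successively.simps(3))
  moreover have "gs x (port v u) (port v w) = gs x w1 w2"
    using Cons.prems edge by (intro gs_port[OF assms(1)]) auto
  ultimately show ?case by auto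
qed

end

section \<open>Counting self-avoiding walks of the transformed graph\<close>

lemma sum_UN_le:
  fixes f :: "'b \<Rightarrow> real"
  assumes "finite I" "\<And>i. i \<in> I \<Longrightarrow> finite (A i)" "\<And>x. 0 \<le> f x"
  shows "sum f (\<Union>i\<in>I. A i) \<le> (\<Sum>i\<in>I. sum f (A i))"
  using assms(1,2)
proof (induction I rule: finite_induct)
  case (insert i I)
  have "sum f (A i \<union> (\<Union>i\<in>I. A i)) \<le> sum f (A i) + sum f (\<Union>i\<in>I. A i)"
    using insert sum.union_inter[of "A i" "\<Union>i\<in>I. A i" f]
      sum_nonneg[of "A i \<inter> (\<Union>i\<in>I. A i)" f] assms(3) by simp
  then show ?case using insert by force
qed simp

context gadget_substitution
begin

lemma simple_tf: "simple_graph (V \<times> \<Gamma>) E1"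
  using simple gadget(2) by (auto simp: simple_graph_def tf_edges_def)

lemma finite_tf_neighbours: "finite {y. E1 x y}"
proof (rule finite_subset)
  show "{y. E1 x y} \<subseteq> ({fst x} \<times> \<Gamma>) \<union> (\<lambda>u. (u, port u (fst x))) ` {u. E (fst x) u}"
    by (auto simp: tf_edges_def)
  show "finite (({fst x} \<times> \<Gamma>) \<union> (\<lambda>u. (u, port u (fst x))) ` {u. E (fst x) u})"
    using gadget(1) finite_neighbours by auto
qed

text \<open>A walk of \<open>Suc m\<close> steps has \<open>m\<close> interior vertices, each giving
  the gadget series, and two ends, each giving at least a constant. Its lifts are disjoint from
  those of other walks, and their lengths lie in the summation window because each gadget
  contributes between 1 and \<open>card \<Gamma>\<close> vertices.\<close>

lemma saws_lower_bound:
  assumes x: "0 < x" and v: "v \<in> V" and a: "a \<in> \<Gamma>"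
  shows "\<exists>\<delta>>0. \<forall>m. \<delta> * (real (card (saws E v (Suc m))) * gs x w1 w2 ^ m)
      \<le> (\<Sum>n=m..card \<Gamma> * (m + 2). real (card (saws E1 (v, a) n)) * x ^ Suc n)"
proof -
  obtain \<delta> M where "0 < \<delta> \<and> \<delta> \<le> M \<and> (\<forall>a\<in>\<Gamma>. \<forall>b\<in>\<Gamma>. \<delta> \<le> gs x a b \<and> gs x a b \<le> M)"
    using gs_bounds[OF x] by (elim exE)
  then have \<delta>: "0 < \<delta>" "\<And>a b. a \<in> \<Gamma> \<Longrightarrow> b \<in> \<Gamma> \<Longrightarrow> \<delta> \<le> gs x a b" by auto
  have "\<delta> * \<delta> * (real (card (saws E v (Suc m))) * gs x w1 w2 ^ m)
      \<le> (\<Sum>n=m..card \<Gamma> * (m + 2). real (card (saws E1 (v, a) n)) * x ^ Suc n)" for m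
  proof -
    let ?S = "saws E v (Suc m)" and ?I = "{m..card \<Gamma> * (m + 2)}"
    have fS: "finite ?S" by (rule finite_saws[OF finite_neighbours])
    have fS1: "finite (saws E1 y n)" for y n by (rule finite_saws[OF finite_tf_neighbours])
    have low: "\<delta> * \<delta> * gs x w1 w2 ^ m \<le> weight x a p w1" if p: "p \<in> ?S" for p
    proof -
      obtain w q where q: "p = v # w # q" "length q = m" "successively E (v # w # q)" "distinct p"
        using p by (auto simp: saws_eq length_Suc_conv)
      obtain b where b: "b \<in> \<Gamma>" "weight x (port w v) (w # q) w1 = gs x w1 w2 ^ length q * gs x b w1"
        using weight_port[of x v w q w1] x q nonbacktracking_if_distinct by fastforce
      have "\<delta> * (gs x w1 w2 ^ m * \<delta>) \<le> gs x a (port v w) * (gs x w1 w2 ^ m * gs x b w1)"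
        using \<delta>(1) \<delta>(2)[OF a port_in(2)] \<delta>(2)[OF b(1) gadget(4)] q(3) gs_nonneg[of x] x
        by (intro mult_mono) auto
      then show ?thesis using b(2) q by (simp add: mult_ac)
    qed
    have "\<delta> * \<delta> * (real (card ?S) * gs x w1 w2 ^ m) = (\<Sum>p\<in>?S. \<delta> * \<delta> * gs x w1 w2 ^ m)"
      by simp
    also have "\<dots> \<le> (\<Sum>p\<in>?S. weight x a p w1)"
      by (intro sum_mono low)
    also have "\<dots> = (\<Sum>p\<in>?S. \<Sum>\<pi>\<in>lifts a p w1. x ^ length \<pi>)"
      by (intro sum.cong refl sum_lifts_eq_weight[symmetric]) (auto simp: saws_eq)
    also have "\<dots> = (\<Sum>\<pi>\<in>(\<Union>p\<in>?S. lifts a p w1). x ^ length \<pi>)"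
    proof (rule sum.UNION_disjoint[symmetric])
      show "\<forall>p\<in>?S. \<forall>p'\<in>?S. p \<noteq> p' \<longrightarrow> lifts a p w1 \<inter> lifts a p' w1 = {}"
      proof (intro ballI impI equals0I)
        fix p p' \<pi> assume "p \<in> ?S" "p' \<in> ?S" "p \<noteq> p'" "\<pi> \<in> lifts a p w1 \<inter> lifts a p' w1"
        moreover from this have "distinct p" "distinct p'" by (auto simp: saws_eq)
        ultimately show False using lifts_base by blast
      qed
    qed (use fS finite_lifts in auto)
    also have "\<dots> \<le> (\<Sum>\<pi>\<in>(\<Union>n\<in>?I. saws E1 (v, a) n). x ^ length \<pi>)"
    proof (rule sum_mono2)
      show "(\<Union>p\<in>?S. lifts a p w1) \<subseteq> (\<Union>n\<in>?I. saws E1 (v, a) n)"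
      proof safe
        fix p and \<pi> :: "('a \<times> 'b) list" assume p: "p \<in> ?S" and \<pi>: "\<pi> \<in> lifts a p w1"
        have p': "length p = m + 2" "hd p = v" "distinct p" "successively E p"
          using p by (auto simp: saws_eq)
        have len: "m + 2 \<le> length \<pi>" "length \<pi> \<le> card \<Gamma> * (m + 2)"
          using length_lifts[OF \<pi> a p'(4)] p'(1) by auto
        have "\<pi> \<in> saws E1 (v, a) (length \<pi> - 1)"
          using lifts_hd[OF \<pi>] lifts_distinct[OF \<pi> p'(3)] lifts_walk[OF \<pi> a p'(4)] p'(2) v
          by (auto simp: saws_eq)
        moreover have "length \<pi> - 1 \<in> ?I" using len by auto
        ultimately show "\<pi> \<in> (\<Union>n\<in>?I. saws E1 (v, a) n)" by blast
      qed
    qed (use fS1 x in auto)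
    also have "\<dots> \<le> (\<Sum>n\<in>?I. \<Sum>\<pi>\<in>saws E1 (v, a) n. x ^ length \<pi>)"
      using fS1 x by (intro sum_UN_le) auto
    also have "\<dots> = (\<Sum>n\<in>?I. real (card (saws E1 (v, a) n)) * x ^ Suc n)"
    proof (rule sum.cong[OF refl])
      fix n
      have "(\<Sum>\<pi>\<in>saws E1 (v, a) n. x ^ length \<pi>) = (\<Sum>\<pi>\<in>saws E1 (v, a) n. x ^ Suc n)"
        by (rule sum.cong) (auto simp: saws_eq)
      then show "(\<Sum>\<pi>\<in>saws E1 (v, a) n. x ^ length \<pi>) = real (card (saws E1 (v, a) n)) * x ^ Suc n"
        by simp
    qed
    finally show ?thesis .
  qed
  then show ?thesis using \<delta>(1) by (intro exI[of _ "\<delta> * \<delta>"]) simp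
qed

section \<open>Projection of self-avoiding walks\<close>

lemma gp_ends: "q \<in> gp a b \<Longrightarrow> a \<in> set q \<and> b \<in> set q"
  by (auto simp: gadget_paths_def)

lemma Cons_mem_lifts:
  assumes "\<pi> \<in> lifts b (v # p) c" "Eg a b" "(v, a) \<notin> set \<pi>"
  shows "(v, a) # \<pi> \<in> lifts a (v # p) c"
proof -
  have ext: "a # q \<in> gp a d" if "q \<in> gp b d" "a \<notin> set q" for q d
    using that assms(2) by (auto simp: gadget_paths_eq successively_Cons)
  show ?thesis
  proof (cases p)
    case Nil
    then obtain q where q: "\<pi> = map (Pair v) q" "q \<in> gp b c" using assms(1) by auto
    then have "a # q \<in> gp a c" using assms(3) by (intro ext) auto
    then have "map (Pair v) (a # q) \<in> lifts a (v # p) c" unfolding Nil lifts.simps by (rule imageI)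
    then show ?thesis using q by simp
  next
    case (Cons w p')
    then obtain q r where q: "\<pi> = map (Pair v) q @ r" "q \<in> gp b (port v w)" "r \<in> lifts (port w v) (w # p') c"
      using assms(1) by auto
    then have "a # q \<in> gp a (port v w)" using assms(3) by (intro ext) auto
    then show ?thesis
      unfolding Cons lifts.simps using q by (intro image_eqI[of _ _ "(a # q, r)"]) auto
  qed
qed

text \<open>Built from the front: a step inside a gadget prolongs the first block, a step along an
  original edge opens a new block consisting of one port. The base walk may revisit
  vertices.\<close>

lemma walk_mem_lifts:
  "\<pi> \<noteq> [] \<Longrightarrow> successively E1 \<pi> \<Longrightarrow> distinct \<pi> \<Longrightarrow> hd \<pi> \<in> V \<times> \<Gamma> \<Longrightarrow>
    \<exists>p. successively E (fst (hd \<pi>) # p) \<and> (\<exists>c\<in>\<Gamma>. \<pi> \<in> lifts (snd (hd \<pi>)) (fst (hd \<pi>) # p) c)"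
proof (induction \<pi> rule: induct_list012)
  case (2 x)
  obtain v a where x: "x = (v, a)" by (cases x)
  have "[a] \<in> gp a a" by (simp add: gadget_paths_eq)
  then have "map (Pair v) [a] \<in> lifts a [v] a" unfolding lifts.simps by (rule imageI)
  then show ?case using 2(4) x by (intro exI[of _ "[]"] conjI bexI[of _ a]) auto
next
  case (3 x y \<pi>)
  obtain v a v' b where xy: "x = (v, a)" "y = (v', b)" by (cases x, cases y)
  have e: "E1 (v, a) (v', b)" using 3 xy by auto
  then have "y \<in> V \<times> \<Gamma>" using xy by (auto simp: tf_edges_def)
  with 3 xy obtain p c where p: "successively E (v' # p)" "c \<in> \<Gamma>" "y # \<pi> \<in> lifts b (v' # p) c"
    by auto
  show ?case
  proof (cases "v = v' \<and> Eg a b")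
    case True
    then have "x # y # \<pi> \<in> lifts a (v # p) c"
      using Cons_mem_lifts[of "y # \<pi>" b v p c a] p xy 3 by auto
    then show ?thesis using p True xy by auto
  next
    case False
    then have e: "E v v'" "a = port v v'" "b = port v' v" using e by (auto simp: tf_edges_def)
    have "x # y # \<pi> \<in> lifts a (v # v' # p) c"
      unfolding lifts.simps using p(3) e xy
      by (intro image_eqI[of _ _ "([a], y # \<pi>)"]) (auto simp: gadget_paths_eq)
    then show ?thesis using p(1,2) e(1) xy by (intro exI[of _ "v' # p"] conjI bexI[of _ c]) auto
  qed
qed simp

text \<open>Turning back from \<open>w\<close> to \<open>v\<close> would re-enter the gadget of
  \<open>v\<close> at the port through which it was left, and that port is already on the
  walk.\<close>

lemma lifts_nonbacktracking: "\<pi> \<in> lifts b p c \<Longrightarrow> distinct \<pi> \<Longrightarrow> nonbacktracking p"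
proof (induction b p c arbitrary: \<pi> rule: lifts.induct)
  case (3 b v w p c)
  then obtain q r where *: "\<pi> = map (Pair v) q @ r" "q \<in> gp b (port v w)" "r \<in> lifts (port w v) (w # p) c"
    by auto
  have IH: "nonbacktracking (w # p)" using "3.IH"[OF *(3)] "3.prems"(2) * by simp
  show ?case
  proof (cases p)
    case (Cons z p')
    then obtain q' r' where **: "r = map (Pair w) q' @ r'" "r' \<in> lifts (port z w) (z # p') c"
      using *(3) by auto
    have "(z, port z w) \<in> set r" using lifts_hd[OF **(2)] **(1) by (cases r') auto
    moreover have "(v, port v w) \<in> set (map (Pair v) q)"
      using gp_ends[OF *(2)] by auto
    ultimately have "z \<noteq> v" using "3.prems"(2) *(1) by auto
    then show ?thesis using IH Cons by simp
  qed simp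
qed simp_all

text \<open>The witnesses are the predecessor and the successor of a visit to \<open>z\<close>. The
  end of the walk is excluded since it has no successor.\<close>

lemma lifts_ports:
  "\<pi> \<in> lifts (port v u) (v # p) c \<Longrightarrow> successively E (u # v # p) \<Longrightarrow> nonbacktracking (u # v # p) \<Longrightarrow>
    z \<in> set (butlast (v # p)) \<Longrightarrow>
    \<exists>s t. s \<noteq> t \<and> E z s \<and> E z t \<and> (z, port z s) \<in> set \<pi> \<and> (z, port z t) \<in> set \<pi>"
proof (induction p arbitrary: u v \<pi>)
  case (Cons w p)
  then obtain q r where *: "\<pi> = map (Pair v) q @ r" "q \<in> gp (port v u) (port v w)" "r \<in> lifts (port w v) (w # p) c"
    by auto
  show ?case
  proof (cases "z = v")
    case True
    have "port v u \<in> set q" "port v w \<in> set q" using gp_ends[OF *(2)] by auto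
    then show ?thesis
      using True *(1) Cons.prems edge by (intro exI[of _ u] exI[of _ w]) auto
  next
    case False
    then show ?thesis using Cons.IH[OF *(3)] Cons.prems *(1) by auto
  qed
qed simp

text \<open>This is where degree 3 enters: two complete passages would occupy four ports. The last
  gadget is entered but not left, so it may be one crossed before, reached through its third port;
  hence \<open>butlast\<close>.\<close>

lemma lifts_distinct_butlast:
  "\<pi> \<in> lifts (port v u) (v # p) c \<Longrightarrow> successively E (u # v # p) \<Longrightarrow> nonbacktracking (u # v # p) \<Longrightarrow>
    distinct \<pi> \<Longrightarrow> distinct (butlast (v # p))"
proof (induction p arbitrary: u v \<pi>)
  case (Cons w p)
  then obtain q r where *: "\<pi> = map (Pair v) q @ r" "q \<in> gp (port v u) (port v w)" "r \<in> lifts (port w v) (w # p) c"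
    by auto
  have "v \<notin> set (butlast (w # p))"
  proof
    assume "v \<in> set (butlast (w # p))"
    with lifts_ports[OF *(3)] Cons.prems obtain s t where st: "s \<noteq> t" "E v s" "E v t"
      "(v, port v s) \<in> set r" "(v, port v t) \<in> set r" by fastforce
    have "port v u \<in> set q" "port v w \<in> set q" using gp_ends[OF *(2)] by auto
    \<comment> \<open>An edge common to both visits would put the same port into \<open>q\<close>
      and into \<open>r\<close>, against self-avoidance.\<close>
    then have "{s, t} \<inter> {u, w} = {}" using st Cons.prems(4) *(1) by auto
    moreover have "u \<noteq> w" "E v u" "E v w" using Cons.prems edge by auto
    ultimately have "card {s, t, u, w} = 4" "{s, t, u, w} \<subseteq> {y. E v y}" using st by auto
    then have "4 \<le> card {y. E v y}" by (metis card_mono finite_neighbours)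
    then show False using degree edge[OF st(2)] by simp
  qed
  moreover have "distinct (butlast (w # p))"
    using Cons.IH[OF *(3)] Cons.prems *(1) by auto
  ultimately show ?case by simp
qed simp

text \<open>The projections of self-avoiding walks: only the two ends may fail to be self-avoiding.\<close>

definition near_saws :: "'a \<Rightarrow> nat \<Rightarrow> 'a list set" where
  "near_saws v k = {v # p |p. length p = k \<and> successively E (v # p) \<and> nonbacktracking (v # p) \<and>
     distinct (butlast p)}"

lemma saws_covered:
  assumes "v \<in> V" "a \<in> \<Gamma>"
  shows "saws E1 (v, a) n \<subseteq> (\<Union>c\<in>\<Gamma>. \<Union>k\<le>n. \<Union>p\<in>near_saws v k. lifts a p c)"
proof
  fix \<pi> assume \<pi>: "\<pi> \<in> saws E1 (v, a) n"
  have \<pi>': "\<pi> \<noteq> []" "successively E1 \<pi>" "distinct \<pi>" "hd \<pi> = (v, a)" "length \<pi> = Suc n"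
    using \<pi> by (auto simp: saws_eq)
  obtain p c where p: "successively E (v # p)" "c \<in> \<Gamma>" "\<pi> \<in> lifts a (v # p) c"
    using walk_mem_lifts[OF \<pi>'(1-3)] \<pi>'(4) assms by auto
  have nb: "nonbacktracking (v # p)" by (rule lifts_nonbacktracking[OF p(3) \<pi>'(3)])
  have "distinct (butlast p)"
  proof (cases p)
    case (Cons w p')
    then obtain q r where "\<pi> = map (Pair v) q @ r" "r \<in> lifts (port w v) (w # p') c"
      using p(3) by auto
    then show ?thesis using lifts_distinct_butlast[of r w v p' c] p(1) nb \<pi>'(3) Cons by auto
  qed simp
  moreover have "length p \<le> n" using length_lifts[OF p(3) assms(2) p(1)] \<pi>'(5) by simp
  ultimately have "length p \<in> {..n}" "v # p \<in> near_saws v (length p)"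
    using p nb by (auto simp: near_saws_def)
  then show "\<pi> \<in> (\<Union>c\<in>\<Gamma>. \<Union>k\<le>n. \<Union>p\<in>near_saws v k. lifts a p c)"
    using p by blast
qed

text \<open>Without its first and last vertex such a walk is self-avoiding with \<open>k - 2\<close>
  steps; three choices at either end give the factor 9. Using \<open>C + 1\<close> makes the bound
  hold for \<open>k = 0\<close> and \<open>k = 1\<close> however small \<open>C\<close> is.\<close>

lemma card_near_saws:
  assumes R: "1 \<le> R" and C: "\<And>n v. v \<in> V \<Longrightarrow> real (card (saws E v n)) \<le> C * R ^ n" and v: "v \<in> V"
  shows "finite (near_saws v k)" "real (card (near_saws v k)) \<le> 9 * (C + 1) * R ^ k"
proof -
  have C0: "0 \<le> C" using order_trans[OF of_nat_0_le_iff C[OF v, of 0]] by simp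
  have "finite (near_saws v k) \<and> real (card (near_saws v k)) \<le> 9 * (C + 1) * R ^ k"
  proof -
    consider "k = 0" | "k = 1" | n where "k = n + 2"
      by (metis One_nat_def add_2_eq_Suc' not0_implies_Suc)
    then show ?thesis
    proof cases
      case 1
      have "near_saws v k \<subseteq> {[v]}" using 1 by (auto simp: near_saws_def)
      moreover from card_mono[OF _ this] have "card (near_saws v k) \<le> 1" by simp
      ultimately show ?thesis using 1 C0 finite_subset by fastforce
    next
      case 2
      have sub: "near_saws v k \<subseteq> (\<lambda>w. [v, w]) ` {w. E v w}"
        using 2 by (auto simp: near_saws_def length_Suc_conv)
      have fin: "finite (near_saws v k)" by (rule finite_surj[OF finite_neighbours sub])
      have "card (near_saws v k) \<le> 3" using surj_card_le[OF finite_neighbours sub] degree[OF v] by simp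
      then have "real (card (near_saws v k)) \<le> 9 * 1" by simp
      also have "\<dots> \<le> 9 * (C + 1) * R ^ k"
        unfolding mult.assoc using C0 R 2 mult_mono[of 1 "C + 1" 1 R] by simp
      finally show ?thesis using fin by simp
    next
      case 3
      let ?S = "SIGMA w:{w. E v w}. SIGMA q:saws E w n. {z. E (last q) z}"
      let ?h = "\<lambda>(w, q, z). v # q @ [z]"
      have fsaws: "finite (saws E w n)" for w by (rule finite_saws[OF finite_neighbours])
      have fS: "finite ?S" by (intro finite_SigmaI finite_neighbours fsaws)
      have sub: "near_saws v k \<subseteq> ?h ` ?S"
      proof
        fix p assume "p \<in> near_saws v k"
        then obtain p' where p': "p = v # p'" "length p' = n + 2" "successively E (v # p')" "distinct (butlast p')"
          using 3 by (auto simp: near_saws_def)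
        then obtain q z where q: "p' = q @ [z]" "length q = Suc n"
          by (cases p' rule: rev_cases) auto
        then have "q \<noteq> []" by auto
        then have "(hd q, q, z) \<in> ?S"
          using p' q by (auto simp: successively_Cons successively_append_iff saws_eq)
        then show "p \<in> ?h ` ?S"
          using p' q by (intro image_eqI[of _ _ "(hd q, q, z)"]) auto
      qed
      have "card (near_saws v k) \<le> card ?S" by (rule surj_card_le[OF fS sub])
      also have "\<dots> = (\<Sum>w\<in>{w. E v w}. \<Sum>q\<in>saws E w n. card {z. E (last q) z})"
        using finite_neighbours fsaws by (simp add: card_SigmaI)
      also have "\<dots> = (\<Sum>w\<in>{w. E v w}. \<Sum>q\<in>saws E w n. 3)"
      proof (intro sum.cong refl degree)
        fix w q assume "w \<in> {w. E v w}" and q: "q \<in> saws E w n"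
        then have "w \<in> V" "q \<noteq> []" using edge by (auto simp: saws_eq)
        then show "last q \<in> V" using set_saw_subset[OF simple _ q] by auto
      qed
      finally have "card (near_saws v k) \<le> (\<Sum>w\<in>{w. E v w}. 3 * card (saws E w n))"
        by (simp add: mult.commute)
      then have "real (card (near_saws v k)) \<le> (\<Sum>w\<in>{w. E v w}. 3 * real (card (saws E w n)))"
        by (metis (mono_tags, lifting) of_nat_le_iff of_nat_mult of_nat_numeral of_nat_sum sum.cong)
      also have "\<dots> \<le> (\<Sum>w\<in>{w. E v w}. 3 * (C * R ^ n))"
        using edge by (intro sum_mono mult_left_mono C) auto
      also have "\<dots> = 9 * (C * R ^ n)" using degree[OF v] by simp
      also have "\<dots> \<le> 9 * ((C + 1) * R ^ k)"
        using C0 R 3 by (intro mult_left_mono mult_mono power_increasing) auto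
      finally show ?thesis using finite_surj[OF fS sub] by (simp only: mult.assoc simp_thms)
    qed
  qed
  then show "finite (near_saws v k)" "real (card (near_saws v k)) \<le> 9 * (C + 1) * R ^ k" by auto
qed

text \<open>A single coefficient is bounded by the generating function of everything that covers it,
  and summing over the projection length \<open>k\<close> leaves a geometric series of ratio
  \<open>R * gs x w1 w2\<close>. The bound does not depend on the start vertex.\<close>

lemma saws_upper_bound:
  assumes x: "0 < x" and R: "1 \<le> R" "R * gs x w1 w2 < 1"
    and C: "\<And>n v. v \<in> V \<Longrightarrow> real (card (saws E v n)) \<le> C * R ^ n"
  shows "\<exists>B. \<forall>v\<in>V. \<forall>a\<in>\<Gamma>. \<forall>n. real (card (saws E1 (v, a) n)) * x ^ Suc n \<le> B"
proof -
  obtain \<delta> M where "0 < \<delta> \<and> \<delta> \<le> M \<and> (\<forall>a\<in>\<Gamma>. \<forall>b\<in>\<Gamma>. \<delta> \<le> gs x a b \<and> gs x a b \<le> M)"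
    using gs_bounds[OF x] by (elim exE)
  then have \<delta>: "0 < \<delta>" "\<delta> \<le> M"
    "\<And>a b. a \<in> \<Gamma> \<Longrightarrow> b \<in> \<Gamma> \<Longrightarrow> \<delta> \<le> gs x a b \<and> gs x a b \<le> M" by auto
  define g where "g = gs x w1 w2"
  have g: "0 < g" using \<delta>(1) \<delta>(3)[OF gadget(4,5)] by (simp add: g_def)
  have gs0: "0 \<le> gs x a b" for a b using gs_nonneg x by simp
  \<comment> \<open>For \<open>k = 0\<close> there is one gadget, of factor at most
    \<open>M\<close>. Otherwise the two end gadgets give \<open>M * M\<close>, and the
    \<open>k - 1\<close> interior ones give \<open>g ^ k / g\<close>.\<close>
  define D where "D = M + M * M / g"
  have weight_le: "weight x a p c \<le> D * g ^ k" if p: "p \<in> near_saws v k" and ac: "a \<in> \<Gamma>" "c \<in> \<Gamma>" for a p c k v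
  proof -
    obtain p' where p': "p = v # p'" "length p' = k" "successively E (v # p')" "nonbacktracking (v # p')"
      using p by (auto simp: near_saws_def)
    show ?thesis
    proof (cases p')
      case Nil
      then show ?thesis using p' \<delta>(1,2) \<delta>(3)[OF ac] g by (simp add: D_def add_increasing2)
    next
      case (Cons w q)
      obtain b where b: "b \<in> \<Gamma>" "weight x (port w v) (w # q) c = g ^ length q * gs x b c"
        using weight_port[of x v w q c] x p' Cons unfolding g_def by auto
      have "weight x a p c = gs x a (port v w) * (g ^ length q * gs x b c)" using p' Cons b by simp
      also have "\<dots> \<le> M * (g ^ length q * M)"
        using \<delta>(1,2) \<delta>(3)[OF ac(1) port_in(2)] \<delta>(3)[OF b(1) ac(2)] p'(3) Cons g gs0
        by (intro mult_mono) auto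
      also have "\<dots> = (M * M / g) * g ^ k" using p'(2) Cons g by auto
      also have "\<dots> \<le> D * g ^ k" using \<delta>(1,2) g by (intro mult_right_mono) (auto simp: D_def)
      finally show ?thesis .
    qed
  qed
  have D0: "0 \<le> D" using \<delta>(1,2) g by (simp add: D_def)
  have C0: "0 \<le> C" if "v \<in> V" for v 
    using order_trans[OF of_nat_0_le_iff C[OF that, of 0]] by simp
  let ?F = "9 * (C + 1) * D"
  show ?thesis
  proof (intro exI ballI allI)
    fix v a n assume v: "v \<in> V" and a: "a \<in> \<Gamma>"
    have fin: "finite (near_saws v k)" for k by (rule card_near_saws[OF R(1) C v])
    have "real (card (saws E1 (v, a) n)) * x ^ Suc n = (\<Sum>\<pi>\<in>saws E1 (v, a) n. x ^ length \<pi>)"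
      by (simp add: saws_eq)
    also have "\<dots> \<le> (\<Sum>\<pi>\<in>(\<Union>c\<in>\<Gamma>. \<Union>k\<le>n. \<Union>p\<in>near_saws v k. lifts a p c). x ^ length \<pi>)"
      using saws_covered[OF v a] x gadget(1) fin finite_lifts by (intro sum_mono2) auto
    also have "\<dots> \<le> (\<Sum>c\<in>\<Gamma>. \<Sum>\<pi>\<in>(\<Union>k\<le>n. \<Union>p\<in>near_saws v k. lifts a p c). x ^ length \<pi>)"
      using x gadget(1) fin finite_lifts by (intro sum_UN_le) auto
    also have "\<dots> \<le> (\<Sum>c\<in>\<Gamma>. \<Sum>k\<le>n. \<Sum>\<pi>\<in>(\<Union>p\<in>near_saws v k. lifts a p c). x ^ length \<pi>)"
      using x fin finite_lifts by (intro sum_mono sum_UN_le) auto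
    also have "\<dots> \<le> (\<Sum>c\<in>\<Gamma>. \<Sum>k\<le>n. \<Sum>p\<in>near_saws v k. \<Sum>\<pi>\<in>lifts a p c. x ^ length \<pi>)"
      using x fin finite_lifts by (intro sum_mono sum_UN_le) auto
    also have "\<dots> \<le> (\<Sum>c\<in>\<Gamma>. \<Sum>k\<le>n. \<Sum>p\<in>near_saws v k. D * g ^ k)"
      using x a by (intro sum_mono order_trans[OF sum_lifts_le_weight weight_le]) auto
    also have "\<dots> = (\<Sum>c\<in>\<Gamma>. \<Sum>k\<le>n. real (card (near_saws v k)) * (D * g ^ k))" by simp
    also have "\<dots> \<le> (\<Sum>c\<in>\<Gamma>. \<Sum>k\<le>n. 9 * (C + 1) * R ^ k * (D * g ^ k))"
      using D0 g by (intro sum_mono mult_right_mono card_near_saws[OF R(1) C v]) auto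
    also have "\<dots> = (\<Sum>c\<in>\<Gamma>. \<Sum>k\<le>n. ?F * (R * g) ^ k)"
      by (simp only: power_mult_distrib mult_ac)
    also have "\<dots> = real (card \<Gamma>) * (?F * (\<Sum>k\<le>n. (R * g) ^ k))"
      by (simp only: sum_distrib_left[symmetric] sum_constant mult.left_commute)
    also have "\<dots> \<le> real (card \<Gamma>) * (?F * (1 / (1 - R * g)))"
    proof -
      have "(1 - R * g) * (\<Sum>k\<le>n. (R * g) ^ k) \<le> 1"
        using sum_gp_basic[of "R * g" n] R(1) g by simp
      then have "(\<Sum>k\<le>n. (R * g) ^ k) \<le> 1 / (1 - R * g)"
        using R(2) by (simp add: g_def field_simps)
      then show ?thesis using C0[OF v] D0 by (intro mult_left_mono) auto
    qed
    finally show "real (card (saws E1 (v, a) n)) * x ^ Suc n \<le> real (card \<Gamma>) * (?F * (1 / (1 - R * g)))" .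
  qed
qed

end


section \<open>Matching the critical points of the two graphs\<close>

context gadget_substitution
begin

lemma gs_strict_mono:
  assumes "0 \<le> x" "x < y"
  shows "gs x w1 w2 < gs y w1 w2"
  unfolding gadget_series_def
proof (rule sum_strict_mono)
  show "x ^ length q < y ^ length q" if "q \<in> gp w1 w2" for q
    using assms gp_bounds(2)[OF gadget(4) that] by (intro power_strict_mono) auto
qed (use finite_gp gadget_paths_nonempty[OF gadget(3,4,5)] in auto)

text \<open>Intermediate value theorem on the unit interval: the series vanishes at 0, as every path
  has a vertex, and at 1 it counts the paths, of which there is at least one. This is why
  \<open>y \<le> 1\<close> is the right range.\<close>

lemma gs_root_exists:
  assumes "0 < y" "y \<le> 1"
  obtains x where "0 < x" "gs x w1 w2 = y"
proof -
  have 0: "gs 0 w1 w2 = 0"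
    unfolding gadget_series_def
    using gp_bounds(2)[OF gadget(4)] by (intro sum.neutral) fastforce
  have "0 < card (gp w1 w2)"
    using finite_gp gadget_paths_nonempty[OF gadget(3,4,5)] by (simp add: card_gt_0_iff)
  then have 1: "y \<le> gs 1 w1 w2" using assms by (simp add: gadget_series_def)
  have "continuous_on {0..1} (\<lambda>x. gs x w1 w2)"
    unfolding gadget_series_def by (intro continuous_intros)
  then obtain x where x: "0 \<le> x" "gs x w1 w2 = y"
    using IVT'[of "\<lambda>x. gs x w1 w2" 0 y 1] 0 1 assms by auto
  then have "x \<noteq> 0" using 0 assms by auto
  then show thesis using x by (intro that[of x]) auto
qed

text \<open>A rate \<open>r\<close> is tested at \<open>y = inverse r\<close>. Strict monotonicity
  of the series puts its value at \<open>y\<close> strictly below or above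
  \<open>inverse \<mu>\<close>, which leaves room for a rate \<open>R\<close> above or
  \<open>\<rho>\<close> below \<open>\<mu>\<close> in the original graph.\<close>

theorem tendsto_root_card_saws_tf:
  assumes \<mu>: "1 \<le> \<mu>"
    and upper: "\<And>R. \<mu> < R \<Longrightarrow> \<exists>C>0. \<forall>n. \<forall>v\<in>V. real (card (saws E v n)) \<le> C * R ^ n"
    and lim: "\<And>v. v \<in> V \<Longrightarrow> (\<lambda>n. root n (real (card (saws E v n)))) \<longlonglongrightarrow> \<mu>"
    and x: "0 < x" "gs x w1 w2 = inverse \<mu>" and v: "v \<in> V" and a: "a \<in> \<Gamma>"
  shows "(\<lambda>n. root n (real (card (saws E1 (v, a) n)))) \<longlonglongrightarrow> inverse x"
proof (rule tendsto_root_if_sparse_lower_bound[where K = "2 * card \<Gamma>"])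
  show "0 < inverse x" using x by simp
  show "0 \<le> real (card (saws E1 (v, a) n))" for n by simp
next
  fix r assume r: "inverse x < r"
  define y where "y = inverse r"
  have r0: "0 < r" using r x(1) by (meson inverse_positive_iff_positive less_trans)
  have y: "0 < y" "y < x" using r r0 x(1) by (auto simp: y_def field_simps)
  have gy: "gs y w1 w2 < inverse \<mu>" "0 < gs y w1 w2"
    using gs_strict_mono[of y x] gs_strict_mono[of 0 y] gs_nonneg[of 0 w1 w2] y x(2) by auto
  then have "\<mu> < inverse (gs y w1 w2)" using \<mu> by (simp add: field_simps)
  then obtain R where R: "\<mu> < R" "R < inverse (gs y w1 w2)" using dense by blast
  obtain C where C: "\<forall>n. \<forall>v\<in>V. real (card (saws E v n)) \<le> C * R ^ n"
    using upper[OF R(1)] by blast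
  have "R * gs y w1 w2 < 1" using R(2) gy(2) by (simp add: field_simps)
  moreover have "1 \<le> R" using R \<mu> by simp
  ultimately obtain B
    where B: "\<forall>v\<in>V. \<forall>a\<in>\<Gamma>. \<forall>n. real (card (saws E1 (v, a) n)) * y ^ Suc n \<le> B"
    using saws_upper_bound[OF y(1), of R C] C by auto
  \<comment> \<open>The extra factor \<open>r\<close> arises because generating functions count
    vertices, one more than steps.\<close>
  have "real (card (saws E1 (v, a) (m + n))) \<le> real (card (saws E1 (v, a) m)) * (B * r * r ^ n)" for m n
  proof (rule card_saws_add_le[OF simple_tf finite_tf_neighbours])
    show "(v, a) \<in> V \<times> \<Gamma>" using v a by simp
    fix u assume "u \<in> V \<times> \<Gamma>"
    then have "real (card (saws E1 u n)) * y ^ Suc n \<le> B" using B by (cases u) auto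
    then show "real (card (saws E1 u n)) \<le> B * r * r ^ n"
      using r0 by (simp add: y_def power_inverse field_simps)
  qed
  then show "\<exists>C. \<forall>m n. real (card (saws E1 (v, a) (m + n))) \<le> real (card (saws E1 (v, a) m)) * (C * r ^ n)"
    by (intro exI[of _ "B * r"]) simp
next
  fix r assume r: "0 < r" "r < inverse x"
  define y where "y = inverse r"
  have y: "0 < y" "x < y" using r x(1) by (auto simp: y_def field_simps)
  define g where "g = gs y w1 w2"
  have g: "inverse \<mu> < g"
    using gs_strict_mono[of x y] y x by (auto simp: g_def)
  have g0: "0 < g" using g \<mu> by (meson inverse_positive_iff_positive less_trans order_less_le_trans zero_less_one)
  then have "inverse g < \<mu>" using g \<mu> by (simp add: field_simps)
  \<comment> \<open>With \<open>\<rho> * g\<close> above 1 the sum over the window grows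
    exponentially in \<open>m\<close> and outweighs the linear number of its terms.\<close>
  then obtain \<rho> where \<rho>: "inverse g < \<rho>" "\<rho> < \<mu>" using dense by blast
  have \<rho>0: "0 < \<rho>" using \<rho> g0 by (meson inverse_positive_iff_positive less_trans)
  have "1 < \<rho> * g" using \<rho> g0 by (simp add: field_simps)
  then obtain c where c: "c > 0" "\<And>m. c * (2 * real m + 1) \<le> (\<rho> * g) ^ m"
    using power_ge_linear by blast
  obtain \<delta> where \<delta>: "0 < \<delta>"
    "\<forall>m. \<delta> * (real (card (saws E v (Suc m))) * g ^ m)
      \<le> (\<Sum>n=m..card \<Gamma> * (m + 2). real (card (saws E1 (v, a) n)) * y ^ Suc n)"
    using saws_lower_bound[OF y(1) v a, folded g_def] by (elim exE conjE)
  have L: "1 \<le> card \<Gamma>" using gadget(1,4) by (metis One_nat_def Suc_leI card_gt_0_iff empty_iff)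
  \<comment> \<open>The window has at most \<open>3 * card \<Gamma> * (2 * m + 1)\<close> lengths;
    the factor \<open>2 * m + 1\<close> cancels against the linear lower bound obtained from
    \<open>c\<close>. The last \<open>r\<close> again turns vertices into steps.\<close>
  define c' where "c' = \<delta> * \<rho> * c / (3 * real (card \<Gamma>)) * r"
  have "\<forall>\<^sub>F n in sequentially. \<rho> < root n (real (card (saws E v n)))"
    using lim[OF v] \<rho>(2) by (rule order_tendstoD(1))
  then have "\<forall>\<^sub>F m in sequentially. \<rho> < root (Suc m) (real (card (saws E v (Suc m))))"
    by (rule eventually_sequentially_Suc[THEN iffD2])
  then have "\<forall>\<^sub>F m in sequentially. \<exists>n. m \<le> n \<and> n \<le> 2 * card \<Gamma> * m + 2 * card \<Gamma> \<and>
      c' * r ^ n \<le> real (card (saws E1 (v, a) n))"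
  proof eventually_elim
    case (elim m)
    let ?I = "{m..card \<Gamma> * (m + 2)}"
    let ?f = "\<lambda>n. real (card (saws E1 (v, a) n)) * y ^ Suc n"
    have "\<rho> ^ Suc m \<le> root (Suc m) (real (card (saws E v (Suc m)))) ^ Suc m"
      using elim \<rho>0 by (intro power_mono) auto
    then have card_ge: "\<rho> ^ Suc m \<le> real (card (saws E v (Suc m)))"
      by (simp only: real_root_pow_pos2 of_nat_0_le_iff zero_less_Suc)
    have "\<delta> * \<rho> * (c * (2 * real m + 1)) \<le> \<delta> * \<rho> * (\<rho> * g) ^ m"
      using c(2) \<delta>(1) \<rho>0 by (intro mult_left_mono) auto
    also have "\<dots> = \<delta> * (\<rho> ^ Suc m * g ^ m)" by (simp add: power_mult_distrib)
    also have "\<dots> \<le> \<delta> * (real (card (saws E v (Suc m))) * g ^ m)"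
      using card_ge \<delta>(1) g0 by (intro mult_left_mono mult_right_mono) auto
    also have "\<dots> \<le> sum ?f ?I" by (rule \<delta>(2)[rule_format])
    finally have sum_ge: "\<delta> * \<rho> * (c * (2 * real m + 1)) \<le> sum ?f ?I" .
    have "m \<le> card \<Gamma> * (m + 2)" using L mult_le_mono[of 1 "card \<Gamma>" m "m + 2"] by simp
    then have "?I \<noteq> {}" by simp
    from ex_ge_average[OF finite_atLeastAtMost this sum_ge]
    have "\<exists>n\<in>?I. \<delta> * \<rho> * (c * (2 * real m + 1)) \<le> real (card ?I) * ?f n" .
    then obtain n where n: "n \<in> ?I" "\<delta> * \<rho> * (c * (2 * real m + 1)) \<le> real (card ?I) * ?f n" ..
    have "card ?I \<le> 3 * card \<Gamma> * (2 * m + 1)"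
      using L by (simp add: algebra_simps)
    then have "real (card ?I) \<le> 3 * real (card \<Gamma>) * (2 * real m + 1)"
      by (metis (mono_tags) of_nat_1 of_nat_add of_nat_le_iff of_nat_mult of_nat_numeral)
    then have "real (card ?I) * ?f n \<le> 3 * real (card \<Gamma>) * (2 * real m + 1) * ?f n"
      using y(1) by (intro mult_right_mono) auto
    with n(2) have "(2 * real m + 1) * (\<delta> * \<rho> * c) \<le> (2 * real m + 1) * (3 * real (card \<Gamma>) * ?f n)"
      by (simp only: mult_ac)
    then have "\<delta> * \<rho> * c \<le> 3 * real (card \<Gamma>) * ?f n"
      by (rule mult_left_le_imp_le) auto
    then have "\<delta> * \<rho> * c / (3 * real (card \<Gamma>)) \<le> ?f n"
      using L by (simp add: field_simps)
    then have "\<delta> * \<rho> * c / (3 * real (card \<Gamma>)) * r ^ Suc n \<le> ?f n * r ^ Suc n"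
      using r(1) by (intro mult_right_mono) auto
    then have "c' * r ^ n \<le> ?f n * r ^ Suc n" by (simp only: c'_def power_Suc mult.assoc)
    also have "\<dots> = real (card (saws E1 (v, a) n))"
      using r(1) by (simp add: y_def power_inverse field_simps)
    finally show ?case using n(1) by (intro exI[of _ n]) (auto simp: algebra_simps)
  qed
  moreover have "0 < c'" using \<delta>(1) \<rho>0 c(1) L r(1) by (simp add: c'_def)
  ultimately show "\<exists>c>0. \<forall>\<^sub>F m in sequentially. \<exists>n. m \<le> n \<and> n \<le> 2 * card \<Gamma> * m + 2 * card \<Gamma> \<and>
      c * r ^ n \<le> real (card (saws E1 (v, a) n))" by blast
qed

end

theorem theorem3p3:
  fixes V :: "'a set" and E :: "'a \<Rightarrow> 'a \<Rightarrow> bool"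
    and \<Gamma> :: "'b set" and Eg :: "'b \<Rightarrow> 'b \<Rightarrow> bool" and w1 w2 w3 :: 'b
    and port :: "'a \<Rightarrow> 'a \<Rightarrow> 'b"
  assumes "simple_graph V E" and "infinite V" and "graph_connected V E"
    and "quasi_transitive V E" and "cubic V E"
    and "is_local_transformation V E \<Gamma> Eg w1 w2 w3 port"
    and "graph_connected (V \<times> \<Gamma>) (tf_edges V E \<Gamma> Eg port)"
  shows "inverse (connective_constant V E) =
         gadget_series Eg w1 w2 (inverse (connective_constant (V \<times> \<Gamma>) (tf_edges V E \<Gamma> Eg port)))"
proof -
  interpret gadget_substitution V E \<Gamma> Eg w1 w2 w3 port
    by unfold_locales fact+
  obtain \<mu> where \<mu>: "1 \<le> \<mu>"
    "\<And>R. \<mu> < R \<Longrightarrow> \<exists>C>0. \<forall>n. \<forall>v\<in>V. real (card (saws E v n)) \<le> C * R ^ n"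
    "\<And>v. v \<in> V \<Longrightarrow> (\<lambda>n. root n (real (card (saws E v n)))) \<longlonglongrightarrow> \<mu>"
    using saws_growth_quasi_transitive[OF assms(1-4) finite_neighbours] by metis
  have "0 < inverse \<mu>" "inverse \<mu> \<le> 1" using \<mu>(1) by (simp_all add: inverse_le_1_iff)
  \<comment> \<open>The root comes first; only afterwards is its inverse identified as the limit.
    Both limits hold at every vertex, so the choice made by \<open>SOME\<close> in
    \<open>connective_constant\<close> is harmless.\<close>
  then obtain x where x: "0 < x" "gs x w1 w2 = inverse \<mu>" by (rule gs_root_exists)
  have "V \<noteq> {}" using assms(2) by auto
  then have "(SOME v. v \<in> V) \<in> V" by (rule some_in_eq[THEN iffD2])
  then have "connective_constant V E = \<mu>"
    unfolding connective_constant_def by (intro limI \<mu>(3))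
  moreover have "connective_constant (V \<times> \<Gamma>) E1 = inverse x"
  proof -
    have "V \<times> \<Gamma> \<noteq> {}" using \<open>V \<noteq> {}\<close> gadget(4) by auto
    then have "(SOME z. z \<in> V \<times> \<Gamma>) \<in> V \<times> \<Gamma>" by (rule some_in_eq[THEN iffD2])
    then obtain v a where "(SOME z. z \<in> V \<times> \<Gamma>) = (v, a)" "v \<in> V" "a \<in> \<Gamma>" by blast
    then show ?thesis
      unfolding connective_constant_def
      using limI[OF tendsto_root_card_saws_tf[OF \<mu> x]] by simp
  qed
  ultimately show ?thesis using x by simp
qed

end
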